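(* Let $G$ be a finite soluble group, $N$ a minimal normal subgroup of $G$, and $x\in G\setminus\{1\}$. Then either $\mathrm d(x,N)\le 3$ in $\Gamma(G)$, or $G$ is a Frobenius group.
   Context: For a group $G$, the normalising graph $\Gamma(G)$ has vertex set $G\setminus\{1\}$, and two distinct vertices $x,y$ are adjacent if and only if $\langle x\rangle$ normalises $\langle y\rangle$ or $\langle y\rangle$ normalises $\langle x\rangle$. $\mathrm d(x,y)$ is graph distance (infinite if there is no path), and for a subset $H$, $\mathrm d(x,H)=\min\{\mathrm d(x,h): h\in H\setminus\{1\}\}$ (with $\mathrm d(x,H)=0$ if $x\in H$). *)

theory Defs
  imports "HOL-Algebra.Algebra" "HOL-Library.Extended_Nat"
begin

definition cyc :: "('a, 'b) monoid_scheme \<Rightarrow> 'a \<Rightarrow> 'a set" where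
  "cyc G x = generate G {x}"

definition normalises :: "('a, 'b) monoid_scheme \<Rightarrow> 'a set \<Rightarrow> 'a set \<Rightarrow> bool" where
  "normalises G A B \<longleftrightarrow> (\<forall>a\<in>A. (\<lambda>b. a \<otimes>\<^bsub>G\<^esub> b \<otimes>\<^bsub>G\<^esub> inv\<^bsub>G\<^esub> a) ` B = B)"

definition norm_adj :: "('a, 'b) monoid_scheme \<Rightarrow> 'a \<Rightarrow> 'a \<Rightarrow> bool" where
  "norm_adj G x y \<longleftrightarrow>
     x \<in> carrier G - {\<one>\<^bsub>G\<^esub>} \<and> y \<in> carrier G - {\<one>\<^bsub>G\<^esub>} \<and> x \<noteq> y \<and>
     (normalises G (cyc G x) (cyc G y) \<or> normalises G (cyc G y) (cyc G x))"

text \<open>Graph distance (infinite if no path).\<close>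
definition norm_dist :: "('a, 'b) monoid_scheme \<Rightarrow> 'a \<Rightarrow> 'a \<Rightarrow> enat" where
  "norm_dist G x y = (INF n \<in> {n. ((norm_adj G) ^^ n) x y}. enat n)"

definition norm_dist_set :: "('a, 'b) monoid_scheme \<Rightarrow> 'a \<Rightarrow> 'a set \<Rightarrow> enat" where
  "norm_dist_set G x H =
     (if x \<in> H then 0 else (INF h \<in> H - {\<one>\<^bsub>G\<^esub>}. norm_dist G x h))"

definition minimal_normal :: "('a, 'b) monoid_scheme \<Rightarrow> 'a set \<Rightarrow> bool" where
  "minimal_normal G N \<longleftrightarrow> N \<lhd> G \<and> N \<noteq> {\<one>\<^bsub>G\<^esub>} \<and>
     (\<forall>M. M \<lhd> G \<and> M \<subseteq> N \<longrightarrow> M = {\<one>\<^bsub>G\<^esub>} \<or> M = N)"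

definition frobenius_group :: "('a, 'b) monoid_scheme \<Rightarrow> bool" where
  "frobenius_group G \<longleftrightarrow> finite (carrier G) \<and>
     (\<exists>H. subgroup H G \<and> H \<noteq> {\<one>\<^bsub>G\<^esub>} \<and> H \<noteq> carrier G \<and>
        (\<forall>g \<in> carrier G - H.
           H \<inter> ((\<lambda>h. g \<otimes>\<^bsub>G\<^esub> h \<otimes>\<^bsub>G\<^esub> inv\<^bsub>G\<^esub> g) ` H) = {\<one>\<^bsub>G\<^esub>}))"

end

theory Submission
  imports Defs
begin

text \<open>
  Suppose that \<open>x\<close> has distance at least 4 from \<open>N\<close>, put \<open>C = C\<^sub>G(N)\<close>, and call vertices near if they are
  equal or adjacent. An element near \<open>x\<close> centralizes no nontrivial element of \<open>C\<close>, and an element at distance at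
  most 2 from \<open>x\<close> is not near any element of \<open>N\<close>. Let \<open>M/C\<close> be a nontrivial abelian normal subgroup of \<open>G/C\<close> of
  prime exponent \<open>q\<close>. If a power \<open>y\<close> of \<open>x\<close> of prime order acted without fixed points on \<open>M/C\<close>, it would fix a
  point of \<open>N\<close>; so \<open>y\<close> centralizes some \<open>m\<close> in \<open>M - C\<close>, which has order \<open>q\<close>. A noncyclic group of order
  \<open>q\<^sup>2\<close> does not act freely (that is, with all nontrivial elements fixing only 1) on \<open>N\<close>, hence the
  centralizer of \<open>y\<close> in \<open>M\<close> is generated by \<open>m\<close>, and \<open>x\<close> normalises it. Repeating the argument with \<open>m\<close> in place of \<open>y\<close> gives \<open>M = C\<langle>m\<rangle>\<close>, and then \<open>H = N\<^sub>G(\<langle>m\<rangle>)\<close> is a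
  complement of \<open>C\<close> in \<open>G\<close> all of whose nontrivial elements have distance at most 2 from \<open>x\<close>.

  In particular \<open>H\<close> acts freely on \<open>N\<close>, and it contains no involution, as that would invert \<open>N\<close>. In such
  a group the elements of prime order commute, so \<open>x\<close> normalises every subgroup of \<open>H\<close> of prime order; these
  therefore act freely on \<open>C\<close>, and \<open>H\<close> is a Frobenius complement.
\<close>

hide_const (open) Divisibility.prime

section \<open>Conjugation and prime order elements\<close>

context group
begin

definition conj_by :: "'a \<Rightarrow> 'a \<Rightarrow> 'a" where
  "conj_by g v = g \<otimes> v \<otimes> inv g"

lemma cancel_left [simp]:
  assumes "x \<in> carrier G" "y \<in> carrier G"
  shows "x \<otimes> (inv x \<otimes> y) = y" "inv x \<otimes> (x \<otimes> y) = y"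
  using assms by (simp_all flip: m_assoc)

lemma conj_by_closed [simp, intro]: "g \<in> carrier G \<Longrightarrow> v \<in> carrier G \<Longrightarrow> conj_by g v \<in> carrier G"
  by (simp add: conj_by_def)

lemma conj_by_comp:
  "g \<in> carrier G \<Longrightarrow> h \<in> carrier G \<Longrightarrow> v \<in> carrier G \<Longrightarrow> conj_by (g \<otimes> h) v = conj_by g (conj_by h v)"
  by (simp add: conj_by_def m_assoc inv_mult_group)

lemma conj_by_mult:
  "g \<in> carrier G \<Longrightarrow> u \<in> carrier G \<Longrightarrow> v \<in> carrier G \<Longrightarrow> conj_by g (u \<otimes> v) = conj_by g u \<otimes> conj_by g v"
  by (simp add: conj_by_def m_assoc)

lemma conj_by_one [simp]: "v \<in> carrier G \<Longrightarrow> conj_by \<one> v = v" "g \<in> carrier G \<Longrightarrow> conj_by g \<one> = \<one>"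
  by (simp_all add: conj_by_def)

lemma conj_by_inv: "g \<in> carrier G \<Longrightarrow> v \<in> carrier G \<Longrightarrow> conj_by g (inv v) = inv (conj_by g v)"
  by (simp add: conj_by_def m_assoc inv_mult_group)

lemma conj_by_pow: "g \<in> carrier G \<Longrightarrow> v \<in> carrier G \<Longrightarrow> conj_by g (v [^] (n::nat)) = conj_by g v [^] n"
  by (induction n) (simp_all add: conj_by_mult)

lemma conj_by_inv_cancel [simp]:
  assumes "g \<in> carrier G" "v \<in> carrier G"
  shows "conj_by g (conj_by (inv g) v) = v" "conj_by (inv g) (conj_by g v) = v"
  using assms by (simp_all flip: conj_by_comp)

lemma conj_by_inj: "g \<in> carrier G \<Longrightarrow> u \<in> carrier G \<Longrightarrow> v \<in> carrier G \<Longrightarrow> conj_by g u = conj_by g v \<longleftrightarrow> u = v"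
  by (metis conj_by_inv_cancel(2))

lemma conj_by_eq_one_iff [simp]: "g \<in> carrier G \<Longrightarrow> v \<in> carrier G \<Longrightarrow> conj_by g v = \<one> \<longleftrightarrow> v = \<one>"
  using conj_by_inj[of g v \<one>] by simp

lemma conj_by_fix_iff: "g \<in> carrier G \<Longrightarrow> v \<in> carrier G \<Longrightarrow> conj_by g v = v \<longleftrightarrow> g \<otimes> v = v \<otimes> g"
  unfolding conj_by_def using inv_solve_right' m_closed by auto

lemma conj_by_fix_pow:
  assumes "g \<in> carrier G" "v \<in> carrier G" "conj_by g v = v"
  shows "conj_by (g [^] (n::nat)) v = v"
  by (induction n) (use assms in \<open>simp_all add: conj_by_comp\<close>)

lemma conj_by_sym:
  "g \<in> carrier G \<Longrightarrow> v \<in> carrier G \<Longrightarrow> conj_by g v = v \<longleftrightarrow> conj_by v g = g"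
  by (metis conj_by_fix_iff)

lemma normal_conj_by: "N \<lhd> G \<Longrightarrow> g \<in> carrier G \<Longrightarrow> v \<in> N \<Longrightarrow> conj_by g v \<in> N"
  unfolding conj_by_def by (rule normal.inv_op_closed2)

lemma pow_eq_one_coprime:
  assumes "x \<in> carrier G" "x [^] (a::nat) = \<one>" "x [^] (b::nat) = \<one>" "coprime a b"
  shows "x = \<one>"
  using assms by (metis coprime_common_divisor_nat ord_eq_1 pow_eq_id)

text \<open>The exponent \<open>k\<close> is prime to \<open>p\<close>, so a Bezout inverse of
  \<open>k\<close> modulo \<open>p\<close> serves as \<open>j\<close>.\<close>

lemma pow_prime_gen:
  assumes "x \<in> carrier G" "x [^] (p::nat) = \<one>" "prime p" "x [^] (k::nat) \<noteq> \<one>"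
  shows "\<exists>j::nat. x = (x [^] k) [^] j"
proof -
  have "\<not> p dvd k"
    using assms(1,2,4) pow_eq_id[of x p] pow_eq_id[of x k] dvd_trans by blast
  then have "coprime k p"
    using assms(3) prime_imp_coprime coprime_commute by blast
  moreover have "k \<noteq> 0" using assms(4) by (intro notI) simp
  ultimately obtain a b where ab: "k * a = p * b + 1"
    using bezout_nat[of k p] by auto
  have "(x [^] k) [^] a = x [^] (p * b + 1)"
    using assms(1) by (simp only: nat_pow_pow ab)
  also have "\<dots> = (x [^] p) [^] b \<otimes> x"
    using assms(1) by (simp add: nat_pow_pow)
  finally have "(x [^] k) [^] a = x"
    using assms(1,2) by simp
  then show ?thesis by metis
qed

lemma exists_prime_pow:
  assumes "x \<in> carrier G" "x \<noteq> \<one>" "finite (carrier G)"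
  shows "\<exists>(k::nat) (p::nat). prime p \<and> x [^] k \<noteq> \<one> \<and> (x [^] k) [^] p = \<one>"
proof -
  have "ord x \<noteq> 1" using assms(2) ord_eq_1[OF assms(1)] by blast
  then obtain p where p: "prime p" "p dvd ord x" using prime_factor_nat by blast
  then obtain k where k: "ord x = p * k" by blast
  have pos: "ord x > 0" using ord_ge_1[OF assms(3,1)] by simp
  then have "0 < k" unfolding k by simp
  moreover have "1 < p" using p(1) by (rule prime_gt_1_nat)
  ultimately have "k < ord x" unfolding k by simp
  with \<open>0 < k\<close> have "\<not> ord x dvd k" by (rule nat_dvd_not_less)
  then have "x [^] k \<noteq> \<one>" by (simp add: pow_eq_id[OF assms(1)])
  moreover have "(x [^] k) [^] p = \<one>"
    unfolding nat_pow_pow[OF assms(1)] pow_eq_id[OF assms(1)] k by (simp only: mult.commute dvd_refl)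
  ultimately show ?thesis using p(1) by meson
qed

lemma mem_cyc_iff:
  assumes "x \<in> carrier G" "finite (carrier G)"
  shows "y \<in> cyc G x \<longleftrightarrow> (\<exists>k::nat. y = x [^] k)"
proof -
  have "ord x \<noteq> 0" using ord_ge_1[OF assms(2,1)] by simp
  then show ?thesis unfolding cyc_def generate_pow_nat[OF assms(1) \<open>ord x \<noteq> 0\<close>] by simp
qed

lemma cyc_subgroup: "x \<in> carrier G \<Longrightarrow> subgroup (cyc G x) G"
  unfolding cyc_def by (rule generate_is_subgroup) auto

end

section \<open>Double products, and fixed points counted modulo a prime\<close>

lemma (in comm_monoid) finprod_swap:
  assumes "finite A" "finite B" "\<And>i j. i \<in> A \<Longrightarrow> j \<in> B \<Longrightarrow> f i j \<in> carrier G"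
  shows "(\<Otimes>i\<in>A. \<Otimes>j\<in>B. f i j) = (\<Otimes>j\<in>B. \<Otimes>i\<in>A. f i j)"
  using assms(1,3)
proof (induction A)
  case empty
  then show ?case by (simp add: finprod_one_eqI)
next
  case (insert a A)
  have "(\<Otimes>i\<in>insert a A. \<Otimes>j\<in>B. f i j) = (\<Otimes>j\<in>B. f a j) \<otimes> (\<Otimes>i\<in>A. \<Otimes>j\<in>B. f i j)"
    using insert by (intro finprod_insert) (auto intro!: finprod_closed)
  also have "\<dots> = (\<Otimes>j\<in>B. f a j \<otimes> (\<Otimes>i\<in>A. f i j))"
    using insert by (subst finprod_multf) (auto intro!: finprod_closed)
  also have "\<dots> = (\<Otimes>j\<in>B. \<Otimes>i\<in>insert a A. f i j)"
    using insert by (intro finprod_cong) (auto intro!: finprod_closed simp: simp_implies_def)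
  finally show ?case .
qed

lemma funpow_cycle_mult: "(f ^^ n) s = s \<Longrightarrow> (f ^^ (n * k)) s = s"
  by (induction k) (simp_all add: funpow_add)

text \<open>The orbits of \<open>f\<close> have length 1 or \<open>p\<close>. The induction discards
  one orbit \<open>O'\<close> of length \<open>p\<close> at a time until every remaining point is
  fixed.\<close>

lemma card_fixed_points_mod_prime:
  assumes "finite S" "f ` S \<subseteq> S" "\<And>s. s \<in> S \<Longrightarrow> (f ^^ p) s = s" "prime (p::nat)"
  shows "card S mod p = card {s \<in> S. f s = s} mod p"
  using assms(1-3)
proof (induction "card S" arbitrary: S rule: less_induct)
  case less
  show ?case
  proof (cases "\<forall>s\<in>S. f s = s")
    case True
    then have "{s \<in> S. f s = s} = S" by auto
    then show ?thesis by simp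
  next
    case False
    then obtain s where s: "s \<in> S" "f s \<noteq> s" by auto
    define O' where "O' = (\<lambda>i. (f ^^ i) s) ` {..<p}"
    have inS: "(f ^^ i) u \<in> S" if "u \<in> S" for i u
      using less(3) that by (induction i) auto
    have per: "(f ^^ i) s \<in> O'" for i
    proof -
      have "(f ^^ i) s = (f ^^ (i mod p + p * (i div p))) s" by simp
      also have "\<dots> = (f ^^ (i mod p)) s"
        unfolding funpow_add o_def using funpow_cycle_mult[of p f s] less(4)[OF s(1)] by simp
      finally show ?thesis using assms(4) prime_gt_0_nat unfolding O'_def by auto
    qed
    \<comment> \<open>By Bezout some multiple of \<open>d\<close> is one more than a multiple of
      \<open>p\<close>, so if \<open>f ^^ d\<close> fixed \<open>s\<close>, then \<open>f\<close>
      would fix it too.\<close>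
    have no: "(f ^^ d) s \<noteq> s" if d0: "0 < d" "d < p" for d
    proof
      assume d: "(f ^^ d) s = s"
      have "coprime d p"
        using that assms(4) nat_dvd_not_less prime_imp_coprime coprime_commute by blast
      then obtain a b where ab: "d * a = p * b + 1"
        using bezout_nat[of d p] d0 by auto
      have "s = (f ^^ (d * a)) s" using funpow_cycle_mult[OF d] by simp
      also have "\<dots> = f ((f ^^ (p * b)) s)" using ab by simp
      also have "\<dots> = f s" using funpow_cycle_mult[of p f s] less(4)[OF s(1)] by simp
      finally show False using s by simp
    qed
    have cO: "card O' = p"
    proof -
      have "inj_on (\<lambda>i. (f ^^ i) s) {..<p}"
      proof (rule linorder_inj_onI')
        fix i j assume ij: "i \<in> {..<p}" "j \<in> {..<p}" "i < j"
        show "(f ^^ i) s \<noteq> (f ^^ j) s"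
        proof
          assume eq: "(f ^^ i) s = (f ^^ j) s"
          have "(f ^^ (p - i)) ((f ^^ i) s) = s"
            using ij less(4)[OF s(1)] funpow_add[of "p - i" i f] by (simp add: fun_eq_iff)
          moreover have "(f ^^ (p - i)) ((f ^^ j) s) = (f ^^ (j - i)) s"
          proof -
            have "(f ^^ (p - i)) ((f ^^ j) s) = (f ^^ (p - i + j)) s" by (simp add: funpow_add)
            also have "p - i + j = (j - i) + p" using ij by simp
            also have "(f ^^ ((j - i) + p)) s = (f ^^ (j - i)) s"
              unfolding funpow_add o_def using less(4)[OF s(1)] by simp
            finally show ?thesis .
          qed
          ultimately show False using no[of "j - i"] ij eq by (simp add: less_imp_diff_less)
        qed
      qed
      then show ?thesis by (simp add: O'_def card_image)
    qed
    have OS: "O' \<subseteq> S" using inS s by (auto simp: O'_def)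
    have notfix: "f u \<noteq> u" if u0: "u \<in> O'" for u
    proof
      assume fu: "f u = u"
      obtain i where i: "u = (f ^^ i) s" "i < p" using u0 by (auto simp: O'_def)
      have "(f ^^ k) u = u" for k by (induction k) (simp_all add: fu)
      then have "u = (f ^^ (p - i)) u" by simp
      also have "\<dots> = (f ^^ (p - i + i)) s" unfolding i(1) funpow_add by simp
      also have "\<dots> = s" using i less(4)[OF s(1)] by simp
      finally show False using fu s by simp
    qed
    \<comment> \<open>If \<open>f u\<close> lies on the orbit, then so does \<open>u\<close>, being
      the image of \<open>f u\<close> under \<open>f ^^ (p - 1)\<close>.\<close>
    have inv: "f ` (S - O') \<subseteq> S - O'"
    proof safe
      fix u assume u: "u \<in> S" "u \<notin> O'"
      then show "f u \<in> S" using less(3) by auto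
      assume "f u \<in> O'"
      then obtain i where "f u = (f ^^ i) s" by (auto simp: O'_def)
      then have "(f ^^ (p - 1)) (f u) = (f ^^ (p - 1 + i)) s" by (simp add: funpow_add)
      moreover have "(f ^^ (p - 1)) (f u) = (f ^^ p) u"
        using assms(4) prime_gt_0_nat[of p] by (metis One_nat_def Suc_pred comp_apply funpow_Suc_right)
      ultimately show False using less(4) u per by metis
    qed
    have fin: "finite O'" by (simp add: O'_def)
    have "card (S - O') < card S"
      using cO OS less(2) assms(4) prime_gt_0_nat[of p]
      by (metis card_Diff_subset card_mono diff_less fin less_le_trans)
    then have "card (S - O') mod p = card {s \<in> S - O'. f s = s} mod p"
      using less(1)[of "S - O'"] inv less(2,4) by auto
    moreover have "{s \<in> S - O'. f s = s} = {s \<in> S. f s = s}" using notfix by auto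
    moreover have "card S = card (S - O') + p"
      using cO OS less(2) by (metis add.commute card_Diff_subset card_mono fin le_add_diff_inverse)
    ultimately show ?thesis by simp
  qed
qed

section \<open>Fixed points on an elementary abelian normal subgroup\<close>

context group
begin

text \<open>The fixed points of conjugation by \<open>g\<close> are the elements commuting with
  \<open>g\<close>. The property fails for \<open>\<one>\<close> as soon as \<open>N\<close> has a
  nontrivial element of \<open>G\<close>, so a free action is stated through the nontrivial elements
  of the acting group.\<close>

definition acts_fpf :: "'a set \<Rightarrow> 'a \<Rightarrow> bool" where
  "acts_fpf N g \<longleftrightarrow> (\<forall>v\<in>N. g \<otimes> v = v \<otimes> g \<longrightarrow> v = \<one>)"

lemma conj_by_pow_Suc:
  "g \<in> carrier G \<Longrightarrow> v \<in> carrier G \<Longrightarrow> conj_by (g [^] Suc n) v = conj_by g (conj_by (g [^] n) v)"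
  unfolding nat_pow_Suc2 by (simp add: conj_by_comp)

lemma funpow_conj_by:
  "g \<in> carrier G \<Longrightarrow> v \<in> carrier G \<Longrightarrow> (conj_by g ^^ n) v = conj_by (g [^] n) v"
  by (induction n) (simp_all add: conj_by_pow_Suc del: nat_pow_Suc Group.nat_pow_Suc)

lemma prime_dvd_card_exponent:
  assumes fin: "finite (carrier G)" and V: "subgroup V G" and p: "prime (p::nat)"
    and v: "v \<in> V" "v \<noteq> \<one>" "v [^] p = \<one>"
  shows "p dvd card V"
proof -
  interpret H: group "G\<lparr>carrier := V\<rparr>" using V by (rule subgroup_imp_group)
  have "v [^]\<^bsub>G\<lparr>carrier := V\<rparr>\<^esub> p = \<one>" using v(3) by (simp flip: nat_pow_consistent)
  then have "H.ord v dvd p" using H.pow_eq_id[of v p] v by simp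
  moreover have "H.ord v \<noteq> 1" using H.ord_eq_1[of v] v by simp
  ultimately have "H.ord v = p" using p by (auto simp: prime_nat_iff)
  moreover have "H.ord v dvd order (G\<lparr>carrier := V\<rparr>)"
    using v finite_subset[OF subgroup.subset[OF V] fin] by (intro H.ord_dvd_group_order) simp
  ultimately show ?thesis by (simp add: order_def)
qed

text \<open>The number of fixed points is divisible by \<open>p\<close>.\<close>

lemma p_element_fixes_point:
  assumes fin: "finite (carrier G)" and V: "subgroup V G" "V \<noteq> {\<one>}" and p: "prime (p::nat)"
    and exp: "\<And>v. v \<in> V \<Longrightarrow> v [^] p = \<one>"
    and g: "g \<in> carrier G" "\<And>v. v \<in> V \<Longrightarrow> conj_by g v \<in> V"
    and gp: "\<And>v. v \<in> V \<Longrightarrow> conj_by (g [^] p) v = v"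
  shows "\<not> acts_fpf V g"
proof
  assume fpf: "acts_fpf V g"
  have VG: "V \<subseteq> carrier G" using V(1) by (rule subgroup.subset)
  have one: "\<one> \<in> V" using V(1) by (rule subgroup.one_closed)
  obtain v where "v \<in> V" "v \<noteq> \<one>" using V(2) one by blast
  then have "p dvd card V" using prime_dvd_card_exponent[OF fin V(1) p] exp by blast
  moreover have "card V mod p = card {v \<in> V. conj_by g v = v} mod p"
    using p finite_subset[OF VG fin] VG g gp
    by (intro card_fixed_points_mod_prime) (auto simp: funpow_conj_by subset_iff)
  moreover have "{v \<in> V. conj_by g v = v} = {\<one>}"
  proof (intro equalityI subsetI)
    fix v assume "v \<in> {v \<in> V. conj_by g v = v}"
    then have "v \<in> V" "g \<otimes> v = v \<otimes> g" using conj_by_fix_iff[OF g(1), of v] VG by blast+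
    then show "v \<in> {\<one>}" using fpf unfolding acts_fpf_def by blast
  qed (use one g(1) in simp)
  ultimately show False using p prime_gt_1_nat[OF p] by simp
qed

end

text \<open>\<open>N\<close> is a vector space over the field with \<open>p\<close> elements,
  written multiplicatively, and \<open>G\<close> acts on it linearly by conjugation. The products
  \<open>finprod NG\<close> below are sums of vectors.\<close>

locale elementary_normal = group G for G (structure) +
  fixes N :: "'a set" and p :: nat
  assumes fin: "finite (carrier G)"
    and N: "N \<lhd> G" and N_nontriv: "N \<noteq> {\<one>}"
    and comm: "\<And>u v. u \<in> N \<Longrightarrow> v \<in> N \<Longrightarrow> u \<otimes> v = v \<otimes> u"
    and p: "prime p" and exp: "\<And>v. v \<in> N \<Longrightarrow> v [^] p = \<one>"
begin

lemma N_subgroup: "subgroup N G"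
  using N by (rule normal_imp_subgroup)

lemma N_carrier: "v \<in> N \<Longrightarrow> v \<in> carrier G"
  using subgroup.subset[OF N_subgroup] by blast

lemma conj_N: "g \<in> carrier G \<Longrightarrow> v \<in> N \<Longrightarrow> conj_by g v \<in> N"
  using N by (rule normal_conj_by)

abbreviation "NG \<equiv> G\<lparr>carrier := N\<rparr>"

sublocale NG: comm_group NG
  rewrites "carrier NG = N" and "monoid.mult NG = monoid.mult G" and "one NG = one G"
  using group.group_comm_groupI[OF subgroup_imp_group[OF N_subgroup]] comm by simp_all

lemma pow_NG: "v [^]\<^bsub>NG\<^esub> (n::nat) = v [^] n"
  by (simp flip: nat_pow_consistent)

lemma conj_finprod:
  assumes "finite T" "g \<in> carrier G" "\<And>t. t \<in> T \<Longrightarrow> f t \<in> N"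
  shows "conj_by g (finprod NG f T) = finprod NG (\<lambda>t. conj_by g (f t)) T"
  using assms(1,3)
proof (induction T)
  case empty
  then show ?case using assms(2) by simp
next
  case (insert t T)
  have "finprod NG f T \<in> N" using insert by (intro NG.finprod_closed) auto
  then show ?case
    using insert assms(2) by (simp add: conj_N Pi_iff conj_by_mult N_carrier)
qed

text \<open>Since \<open>g [^] r\<close> fixes \<open>v\<close>, conjugation by \<open>g\<close>
  shifts the factors cyclically. The product is thus a fixed point of \<open>g\<close> in
  \<open>N\<close>.\<close>

lemma fpf_orbit_product:
  assumes "g \<in> carrier G" "0 < (r::nat)" "acts_fpf N g" "v \<in> N" "conj_by (g [^] r) v = v"
  shows "finprod NG (\<lambda>i. conj_by (g [^] i) v) {..<r} = \<one>"
proof -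
  define f where "f i = conj_by (g [^] (i::nat)) v" for i
  have fN: "f i \<in> N" for i using assms by (simp add: f_def conj_N)
  have "conj_by g (finprod NG f {..<r}) = finprod NG (\<lambda>i. conj_by g (f i)) {..<r}"
    using assms fN by (intro conj_finprod) auto
  also have "\<dots> = finprod NG (\<lambda>i. f (Suc i)) {..<r}"
    using assms N_carrier by (simp add: f_def conj_by_pow_Suc del: nat_pow_Suc Group.nat_pow_Suc)
  also have "\<dots> = finprod NG f {..<r}"
  proof -
    obtain s where s: "r = Suc s" using assms(2) gr0_implies_Suc by blast
    have "f (Suc s) = f 0" using assms N_carrier by (simp add: f_def s del: nat_pow_Suc Group.nat_pow_Suc)
    then have "finprod NG (\<lambda>i. f (Suc i)) {..s} = finprod NG (\<lambda>i. f (Suc i)) {..<s} \<otimes> f 0"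
      using fN by (simp add: lessThan_Suc_atMost[symmetric] lessThan_Suc Pi_iff NG.m_comm)
    moreover have "finprod NG f {..s} = finprod NG (\<lambda>i. f (Suc i)) {..<s} \<otimes> f 0"
      using fN NG.finprod_Suc2[of f] 
      by (cases s) (simp_all add: Pi_iff lessThan_Suc_atMost)
    ultimately show ?thesis by (simp add: s lessThan_Suc_atMost)
  qed
  finally have "g \<otimes> finprod NG f {..<r} = finprod NG f {..<r} \<otimes> g"
    using assms fN N_carrier NG.finprod_closed[of f] by (subst conj_by_fix_iff[symmetric]) (auto simp: Pi_iff)
  then show ?thesis
    using assms(3) fN NG.finprod_closed[of f] unfolding acts_fpf_def f_def by (simp add: Pi_iff)
qed

text \<open>Sum \<open>z\<^sub>k\<^sup>i v\<close> over all \<open>i < r\<close> and \<open>k \<in> T\<close>: summing over \<open>i\<close> first gives zero because each \<open>z\<^sub>k\<close> has no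
  fixed points, while summing over \<open>k\<close> first leaves only the contribution of \<open>i = 0\<close>.\<close>

lemma pow_card_eq_one:
  assumes T: "finite T" and y: "y \<in> carrier G" and r: "0 < (r::nat)"
    and z: "\<And>k. k \<in> T \<Longrightarrow> z k \<in> carrier G" "\<And>k. k \<in> T \<Longrightarrow> acts_fpf N (z k)"
      "\<And>k v. k \<in> T \<Longrightarrow> v \<in> N \<Longrightarrow> conj_by (z k [^] r) v = v"
    and u: "\<And>i k. i < r \<Longrightarrow> k \<in> T \<Longrightarrow> u i k \<in> carrier G"
      "\<And>k v. k \<in> T \<Longrightarrow> v \<in> N \<Longrightarrow> conj_by (u 0 k) v = v"
    and rel: "\<And>i k v. i < r \<Longrightarrow> k \<in> T \<Longrightarrow> v \<in> N \<Longrightarrow>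
      conj_by (z k [^] i) v = conj_by (u i k) (conj_by (y [^] i) v)"
    and inv: "\<And>i w. 0 < i \<Longrightarrow> i < r \<Longrightarrow> w \<in> N \<Longrightarrow> finprod NG (\<lambda>k. conj_by (u i k) w) T = \<one>"
    and v: "v \<in> N"
  shows "v [^] card T = \<one>"
proof -
  have "\<one> = finprod NG (\<lambda>k. finprod NG (\<lambda>i. conj_by (z k [^] i) v) {..<r}) T"
    using z r v by (intro NG.finprod_one_eqI[symmetric] fpf_orbit_product) auto
  also have "\<dots> = finprod NG (\<lambda>i. finprod NG (\<lambda>k. conj_by (z k [^] i) v) T) {..<r}"
    using T z v by (intro NG.finprod_swap) (auto simp: conj_N)
  also have "\<dots> = finprod NG (\<lambda>i. if i = 0 then v [^] card T else \<one>) {..<r}"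
  proof (intro NG.finprod_cong' refl)
    fix i assume "i \<in> {..<r}"
    then have i: "i < r" by simp
    have "finprod NG (\<lambda>k. conj_by (z k [^] i) v) T =
        finprod NG (\<lambda>k. conj_by (u i k) (conj_by (y [^] i) v)) T"
      using i rel v u y by (intro NG.finprod_cong') (auto simp: conj_N)
    also have "\<dots> = (if i = 0 then v [^] card T else \<one>)"
    proof (cases "i = 0")
      case True
      have "finprod NG (\<lambda>k. conj_by (u i k) (conj_by (y [^] i) v)) T = finprod NG (\<lambda>k. v) T"
        using v True u(2) N_carrier by (intro NG.finprod_cong') auto
      then show ?thesis using True v by (simp add: NG.finprod_const pow_NG)
    next
      case False
      then show ?thesis using inv[of i] i v y by (simp add: conj_N)
    qed
    finally show "finprod NG (\<lambda>k. conj_by (z k [^] i) v) T = (if i = 0 then v [^] card T else \<one>)" .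
  qed (use v pow_NG NG.nat_pow_closed[of v "card T"] in auto)
  also have "\<dots> = v [^] card T"
    using r v pow_NG NG.nat_pow_closed[of v "card T"]
    by (intro NG.finprod_singleton_swap[of 0 "{..<r}" "\<lambda>_. v [^] card T"]) auto
  finally show ?thesis by simp
qed

end

section \<open>Cauchy's theorem and transversals\<close>

context group
begin

lemma commute_pow:
  assumes "x \<otimes> y = y \<otimes> x" "x \<in> carrier G" "y \<in> carrier G"
  shows "x [^] (i::nat) \<otimes> y [^] (j::nat) = y [^] j \<otimes> x [^] i"
proof -
  have "conj_by (x [^] i) y = y"
    using assms by (intro conj_by_fix_pow) (simp_all add: conj_by_fix_iff)
  then have "conj_by y (x [^] i) = x [^] i" using assms by (simp add: conj_by_sym[of y])
  then have "conj_by (y [^] j) (x [^] i) = x [^] i" using assms by (intro conj_by_fix_pow) auto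
  then show ?thesis using assms by (simp add: conj_by_fix_iff)
qed

lemma acts_fpf_conj_by:
  assumes N: "N \<lhd> G" and k: "k \<in> carrier G" and y: "y \<in> carrier G" "acts_fpf N y"
  shows "acts_fpf N (conj_by k y)"
  unfolding acts_fpf_def
proof (intro ballI impI)
  fix v assume v: "v \<in> N" and c: "conj_by k y \<otimes> v = v \<otimes> conj_by k y"
  have vG: "v \<in> carrier G" using v N normal_imp_subgroup subgroup.subset by blast
  have "conj_by (inv k) (conj_by k y \<otimes> v) = conj_by (inv k) (v \<otimes> conj_by k y)" using c by simp
  then have "y \<otimes> conj_by (inv k) v = conj_by (inv k) v \<otimes> y"
    using k y vG by (simp add: conj_by_mult)
  moreover have "conj_by (inv k) v \<in> N" using normal_conj_by[OF N, of "inv k" v] k v by simp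
  ultimately have "conj_by (inv k) v = \<one>" using y(2) unfolding acts_fpf_def by blast
  then show "v = \<one>" using k vG by simp
qed

text \<open>Cauchy's theorem, obtained from \<open>sylow_thm\<close> with exponent 1.\<close>

lemma exists_prime_order:
  assumes fin: "finite (carrier G)" and p: "prime (p::nat)" and dvd: "p dvd order G"
  shows "\<exists>z\<in>carrier G. z \<noteq> \<one> \<and> z [^] p = \<one>"
proof -
  obtain m where "order G = p ^ 1 * m" using dvd by (auto elim: dvdE)
  then obtain P where P: "subgroup P G" "card P = p ^ 1"
    using sylow_thm[OF p is_group _ fin] by blast
  interpret P: group "G\<lparr>carrier := P\<rparr>" using P(1) by (rule subgroup_imp_group)
  have "P \<noteq> {\<one>}" using P(2) prime_gt_1_nat[OF p] by auto
  then obtain z where z: "z \<in> P" "z \<noteq> \<one>" using subgroup.one_closed[OF P(1)] by blast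
  have "z [^] p = \<one>"
    using P.pow_order_eq_1[of z] z P(2) by (simp add: order_def flip: nat_pow_consistent)
  then show ?thesis using z subgroup.mem_carrier[OF P(1)] by blast
qed

text \<open>\<open>T\<close> represents each left coset of \<open>C\<close> in \<open>M\<close>
  exactly once, so \<open>card T\<close> is the index of \<open>C\<close>. The factor group has
  exponent dividing \<open>q\<close>, hence by Cauchy's theorem no other prime divides its
  order.\<close>

lemma exists_transversal:
  assumes fin: "finite (carrier G)" and M: "subgroup M G" and C: "C \<lhd> G" "C \<subseteq> M"
    and q: "prime (q::nat)" "\<And>m. m \<in> M \<Longrightarrow> m [^] q \<in> C" and p: "prime (p::nat)" "p \<noteq> q"
  shows "\<exists>T\<subseteq>M. (\<forall>m\<in>M. \<exists>t\<in>T. \<exists>c\<in>C. m = t \<otimes> c) \<and>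
    (\<forall>t\<in>T. \<forall>c\<in>C. t \<otimes> c \<in> T \<longrightarrow> t \<otimes> c = t) \<and> \<not> p dvd card T"
proof -
  interpret C: normal C G by (rule C)
  have MG: "M \<subseteq> carrier G" using M by (rule subgroup.subset)
  define R where "R = (\<lambda>m. C #> m) ` M"
  define rep where "rep K = (SOME m. m \<in> K)" for K :: "'a set"
  have rep: "rep (C #> m) \<in> C #> m" if "m \<in> M" for m
    using rcos_self[OF _ C.subgroup_axioms, of m] that MG unfolding rep_def by (intro someI_ex[of "\<lambda>x. x \<in> C #> m"]) auto
  have RM: "C #> m \<subseteq> M" if "m \<in> M" for m
    using that C(2) subgroup.m_closed[OF M] by (auto simp: r_coset_def)
  have same: "C #> x = C #> m" if "m \<in> M" "x \<in> C #> m" for x m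
    using that MG repr_independence[OF that(2) _ C.subgroup_axioms] by auto
  have inj: "inj_on rep R"
    unfolding R_def by (intro inj_onI) (metis (no_types, lifting) imageE rep same)
  have "\<not> p dvd card (rep ` R)"
  proof
    assume d: "p dvd card (rep ` R)"
    have nM: "C \<lhd> (G\<lparr>carrier := M\<rparr>)" using normal_restrict_supergroup[OF M C] .
    interpret Q: group "(G\<lparr>carrier := M\<rparr>) Mod C" using nM by (rule normal.factorgroup_is_group)
    have R: "carrier ((G\<lparr>carrier := M\<rparr>) Mod C) = R" by (simp add: carrier_FactGroup R_def)
    have "finite R" using finite_subset[OF MG fin] by (simp add: R_def)
    then obtain z where z: "z \<in> R" "z \<noteq> C" "z [^]\<^bsub>(G\<lparr>carrier := M\<rparr>) Mod C\<^esub> p = C"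
      using Q.exists_prime_order[of p] d p(1) inj R by (auto simp: order_def card_image)
    then obtain m where m: "m \<in> M" "z = C #> m" by (auto simp: R_def)
    have "z [^]\<^bsub>(G\<lparr>carrier := M\<rparr>) Mod C\<^esub> q = C #> (m [^] q)"
      using normal.FactGroup_pow[OF nM, of m q] m by (simp flip: nat_pow_consistent)
    also have "\<dots> = C" using q(2)[OF m(1)] C.rcos_const by simp
    finally have "z = C"
      using Q.pow_eq_one_coprime[of z q p] z R q(1) p by (simp add: primes_coprime)
    then show False using z by simp
  qed
  moreover have "\<exists>t\<in>rep ` R. \<exists>c\<in>C. m = t \<otimes> c" if mM: "m \<in> M" for m
  proof -
    obtain c where c: "c \<in> C" "rep (C #> m) = c \<otimes> m" using rep[OF mM] by (auto simp: r_coset_def)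
    have mG: "m \<in> carrier G" using mM MG by auto
    \<comment> \<open>The representatives were chosen in right cosets; normality moves the factor
      from \<open>C\<close> to the right side.\<close>
    have "inv m \<otimes> inv c \<otimes> m \<in> C" using c mG C.inv_op_closed1[of m "inv c"] by simp
    moreover have "m = c \<otimes> m \<otimes> (inv m \<otimes> inv c \<otimes> m)" using c mG by (simp add: m_assoc)
    ultimately show ?thesis using c mM unfolding R_def by (metis imageI)
  qed
  moreover have "t \<otimes> c = t" if tc: "t \<in> rep ` R" "c \<in> C" "t \<otimes> c \<in> rep ` R" for t c
  proof -
    obtain m m' where m: "m \<in> M" "t = rep (C #> m)" and m': "m' \<in> M" "t \<otimes> c = rep (C #> m')"
      using tc by (auto simp: R_def)
    have t: "t \<in> C #> m" "t \<otimes> c \<in> C #> m'" using rep m m' by auto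
    have tM: "t \<in> M" using t m RM by blast
    then have tG: "t \<in> carrier G" using MG by blast
    have "t \<otimes> c = t \<otimes> c \<otimes> inv t \<otimes> t" using tG tc(2) by (simp add: m_assoc)
    moreover have "t \<otimes> c \<otimes> inv t \<in> C" using tG tc(2) by (rule C.inv_op_closed2)
    ultimately have "t \<otimes> c \<in> C #> t" unfolding r_coset_def by blast
    then have "C #> m = C #> m'" using same t m(1) m'(1) tM by metis
    then show ?thesis using m m' by simp
  qed
  moreover have "rep ` R \<subseteq> M" using rep RM by (auto simp: R_def)
  ultimately show ?thesis by (intro exI[of _ "rep ` R"]) blast
qed

end

context elementary_normal
begin

lemma prime_order_fpf_neq:
  assumes "w \<in> carrier G" "w [^] (t::nat) = \<one>" "prime t" "acts_fpf N w"
  shows "t \<noteq> p"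
  using p_element_fixes_point[OF fin N_subgroup N_nontriv p exp, of w] assms conj_N N_carrier by auto

context
  fixes M C T
  assumes M: "subgroup M G" and C: "subgroup C G" "C \<subseteq> M" "\<And>c v. c \<in> C \<Longrightarrow> v \<in> N \<Longrightarrow> c \<otimes> v = v \<otimes> c"
    and M_nofix: "\<And>v. v \<in> N \<Longrightarrow> (\<And>m. m \<in> M \<Longrightarrow> m \<otimes> v = v \<otimes> m) \<Longrightarrow> v = \<one>"
    and T: "T \<subseteq> M" "\<And>m. m \<in> M \<Longrightarrow> \<exists>t\<in>T. \<exists>c\<in>C. m = t \<otimes> c"
      "\<And>t c. t \<in> T \<Longrightarrow> c \<in> C \<Longrightarrow> t \<otimes> c \<in> T \<Longrightarrow> t \<otimes> c = t"
begin

text \<open>\<open>C\<close> acts trivially on \<open>N\<close>, so \<open>conj_by t w\<close>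
  depends only on the coset of \<open>t\<close>. By \<open>inj\<close> the map \<open>g\<close>
  induces a permutation of the cosets, and \<open>h\<close> is this permutation read on
  representatives.\<close>

lemma finprod_transversal_eq:
  assumes w: "w \<in> N" and g: "\<And>t. t \<in> T \<Longrightarrow> g t \<in> M"
    and inj: "\<And>t t' c. t \<in> T \<Longrightarrow> t' \<in> T \<Longrightarrow> c \<in> C \<Longrightarrow> g t' = g t \<otimes> c \<Longrightarrow> t = t'"
  shows "finprod NG (\<lambda>t. conj_by (g t) w) T = finprod NG (\<lambda>t. conj_by t w) T"
proof -
  note MG = subgroup.mem_carrier[OF M] and CG = subgroup.mem_carrier[OF C(1)]
  have fT: "finite T" using T(1) subgroup.subset[OF M] fin by (meson finite_subset)
  have "\<forall>t\<in>T. \<exists>s. s \<in> T \<and> (\<exists>c\<in>C. g t = s \<otimes> c)" using T(2) g by blast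
  then obtain h where h: "\<And>t. t \<in> T \<Longrightarrow> h t \<in> T \<and> (\<exists>c\<in>C. g t = h t \<otimes> c)" by metis
  have "inj_on h T"
  proof (rule inj_onI)
    fix t t' assume t: "t \<in> T" "t' \<in> T" "h t = h t'"
    then obtain c c' where c: "c \<in> C" "g t = h t \<otimes> c" and c': "c' \<in> C" "g t' = h t \<otimes> c'"
      using h by metis
    have "h t \<in> carrier G" using h[OF t(1)] T(1) MG by blast
    then have "g t' = g t \<otimes> (inv c \<otimes> c')"
      unfolding c(2) c'(2) using c(1) c'(1) CG by (simp add: m_assoc)
    then show "t = t'" using inj[OF t(1,2), of "inv c \<otimes> c'"] c c' C(1)
      by (simp add: subgroup.m_closed subgroup.m_inv_closed)
  qed
  moreover have "h ` T \<subseteq> T" using h by auto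
  ultimately have hT: "h ` T = T" using endo_inj_surj[OF fT] by blast
  have "conj_by (g t) w = conj_by (h t) w" if tT: "t \<in> T" for t
  proof -
    obtain c where c: "c \<in> C" "g t = h t \<otimes> c" using h tT by blast
    have "conj_by c w = w" using C(3)[OF c(1) w] CG[OF c(1)] N_carrier[OF w] by (simp add: conj_by_fix_iff)
    moreover have "h t \<in> carrier G" using h[OF tT] T(1) MG by blast
    ultimately show ?thesis using c CG N_carrier w by (simp add: conj_by_comp)
  qed
  moreover have hG: "h t \<in> carrier G" if "t \<in> T" for t using h[OF that] T(1) MG by blast
  ultimately have "finprod NG (\<lambda>t. conj_by (g t) w) T = finprod NG (\<lambda>t. conj_by (h t) w) T"
    using w by (intro NG.finprod_cong') (auto simp: conj_N)
  also have "\<dots> = finprod NG (\<lambda>t. conj_by t w) (h ` T)"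
    using \<open>inj_on h T\<close> w hG by (intro NG.finprod_reindex[symmetric]) (auto simp: conj_N)
  finally show ?thesis using hT by simp
qed

text \<open>Left multiplication by an element of \<open>M\<close> permutes the cosets, so the
  product over \<open>T\<close> is fixed by all of \<open>M\<close> and is trivial by
  \<open>M_nofix\<close>. Replacing \<open>t\<close> by \<open>g t\<close> does not change
  it.\<close>

lemma finprod_transversal_eq_one:
  assumes w: "w \<in> N" and g: "\<And>t. t \<in> T \<Longrightarrow> g t \<in> M"
    and inj: "\<And>t t' c. t \<in> T \<Longrightarrow> t' \<in> T \<Longrightarrow> c \<in> C \<Longrightarrow> g t' = g t \<otimes> c \<Longrightarrow> t = t'"
  shows "finprod NG (\<lambda>t. conj_by (g t) w) T = \<one>"
proof -
  note MG = subgroup.mem_carrier[OF M] and CG = subgroup.mem_carrier[OF C(1)]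
  have fT: "finite T" using T(1) subgroup.subset[OF M] fin by (meson finite_subset)
  have TG: "t \<in> carrier G" if "t \<in> T" for t using that T(1) MG by blast
  define P where "P = finprod NG (\<lambda>t. conj_by t w) T"
  have PN: "P \<in> N" unfolding P_def using w TG conj_N by (intro NG.finprod_closed) auto
  have "m \<otimes> P = P \<otimes> m" if m: "m \<in> M" for m
  proof -
    have "conj_by m P = finprod NG (\<lambda>t. conj_by m (conj_by t w)) T"
      unfolding P_def using fT MG m w TG by (intro conj_finprod) (auto simp: conj_N)
    also have "\<dots> = finprod NG (\<lambda>t. conj_by (m \<otimes> t) w) T"
      using MG m w TG N_carrier by (intro NG.finprod_cong') (auto simp: conj_N conj_by_comp)
    also have "\<dots> = P"
      unfolding P_def
    proof (intro finprod_transversal_eq w)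
      show "m \<otimes> t \<in> M" if "t \<in> T" for t using that T(1) m subgroup.m_closed[OF M] by blast
      fix t t' c assume t: "t \<in> T" "t' \<in> T" "c \<in> C" "m \<otimes> t' = m \<otimes> t \<otimes> c"
      have "m \<otimes> t' = m \<otimes> (t \<otimes> c)" using t TG CG MG[OF m] by (simp add: m_assoc)
      then have "t' = t \<otimes> c" using t TG CG MG[OF m] by simp
      then show "t = t'" using T(3)[of t c] t by simp
    qed
    finally show ?thesis using MG[OF m] PN N_carrier by (simp add: conj_by_fix_iff)
  qed
  then have "P = \<one>" using M_nofix PN by blast
  then show ?thesis using finprod_transversal_eq[of w g] w g inj by (simp add: P_def)
qed

end

end

section \<open>Frobenius groups acting on \<open>N\<close>\<close>

context elementary_normal
begin

lemma pow_transversal_eq_one: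
  assumes v: "v \<in> N" "v [^] n = \<one>" "\<not> p dvd (n::nat)"
  shows "v = \<one>"
  using pow_eq_one_coprime[OF N_carrier[OF v(1)] exp[OF v(1)] v(2)] v(3) p
  by (simp add: prime_imp_coprime)

text \<open>Contrapositive of a classical fact: when a Frobenius group with kernel
  \<open>M/C\<close> and complement generated by \<open>y\<close> acts on \<open>N\<close>, and the
  kernel has order prime to \<open>p\<close> and fixes no nontrivial vector, then \<open>y\<close>
  fixes one. If no \<open>y [^] i\<close> with \<open>0 < i < r\<close> commuted modulo
  \<open>C\<close> with an element of \<open>M - C\<close>, the commutators of the elements of
  \<open>T\<close> with \<open>y [^] i\<close> would lie in distinct cosets of \<open>C\<close>, and
  \<open>pow_card_eq_one\<close> would give a nontrivial vector killed by both \<open>p\<close> and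
  \<open>card T\<close>.\<close>

lemma frobenius_kernel_action:
  assumes M: "subgroup M G" and C: "C \<lhd> G" "C \<subseteq> M" "\<And>c v. c \<in> C \<Longrightarrow> v \<in> N \<Longrightarrow> c \<otimes> v = v \<otimes> c"
    and M_nofix: "\<And>v. v \<in> N \<Longrightarrow> (\<And>m. m \<in> M \<Longrightarrow> m \<otimes> v = v \<otimes> m) \<Longrightarrow> v = \<one>"
    and q: "prime (q::nat)" "\<And>m. m \<in> M \<Longrightarrow> m [^] q \<in> C" "q \<noteq> p"
    and y: "y \<in> carrier G" "\<And>m. m \<in> M \<Longrightarrow> conj_by y m \<in> M" "acts_fpf N y"
    and r: "y [^] r = \<one>" "0 < (r::nat)"
  shows "\<exists>i m. 0 < i \<and> i < r \<and> m \<in> M - C \<and> conj_by m (y [^] i) \<otimes> inv (y [^] i) \<in> C"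
proof (rule ccontr)
  assume contra: "\<not> ?thesis"
  interpret C: normal C G by (rule C)
  obtain T where T: "T \<subseteq> M" "\<And>m. m \<in> M \<Longrightarrow> \<exists>t\<in>T. \<exists>c\<in>C. m = t \<otimes> c"
      "\<And>t c. t \<in> T \<Longrightarrow> c \<in> C \<Longrightarrow> t \<otimes> c \<in> T \<Longrightarrow> t \<otimes> c = t" "\<not> p dvd card T"
    using exists_transversal[OF fin M C(1,2) q(1,2) p] q(3) by blast
  note MG = subgroup.mem_carrier[OF M]
  have TG: "t \<in> carrier G" if "t \<in> T" for t using that T(1) MG by blast
  have fT: "finite T" using T(1) subgroup.subset[OF M] fin by (meson finite_subset)
  \<comment> \<open>The conjugates \<open>z k\<close> of \<open>y\<close> are again without fixed
    points, and the commutator \<open>u i k\<close> is the factor by which the \<open>i\<close>-th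
    powers of \<open>z k\<close> and \<open>y\<close> differ.\<close>
  define z where "z k = conj_by k y" for k
  define u where "u i k = conj_by k (y [^] (i::nat)) \<otimes> inv (y [^] i)" for i k
  have zpow: "z k [^] i = conj_by k (y [^] i)" if "k \<in> T" for k and i :: nat
    using that TG y(1) by (simp add: z_def conj_by_pow)
  have yM: "conj_by (y [^] i) m \<in> M" if "m \<in> M" for m and i :: nat
  proof (induction i)
    case (Suc i)
    then show ?case
      using y(1) that MG conj_by_pow_Suc y(2) by (simp del: nat_pow_Suc Group.nat_pow_Suc)
  qed (use that MG in simp)
  have uM: "u i k \<in> M" if "k \<in> T" for i k
  proof -
    have "u i k = k \<otimes> conj_by (y [^] i) (inv k)"
      using that TG y(1) by (simp add: u_def conj_by_def m_assoc)
    then show ?thesis using that T(1) yM M by (auto intro!: subgroup.m_closed subgroup.m_inv_closed)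
  qed
  obtain v where v: "v \<in> N" "v \<noteq> \<one>"
    using N_nontriv subgroup.one_closed[OF N_subgroup] by blast
  have "v [^] card T = \<one>"
  proof (rule pow_card_eq_one[where z = z and u = u and y = y and r = r, OF fT y(1) r(2)])
    fix k assume k: "k \<in> T"
    then show "z k \<in> carrier G" using TG y(1) by (simp add: z_def)
    show "acts_fpf N (z k)" using acts_fpf_conj_by[OF N TG[OF k] y(1,3)] by (simp add: z_def)
    show "conj_by (z k [^] r) v = v" if "v \<in> N" for v
      using that k TG N_carrier by (simp add: zpow r(1))
    show "conj_by (u 0 k) v = v" if "v \<in> N" for v using that k TG N_carrier by (simp add: u_def)
    fix i assume "i < r"
    then show "u i k \<in> carrier G" using TG[OF k] y(1) by (simp add: u_def)
    show "conj_by (z k [^] i) v = conj_by (u i k) (conj_by (y [^] i) v)" if "v \<in> N" for v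
      unfolding zpow[OF k] u_def using that TG[OF k] y(1) N_carrier
      by (simp add: m_assoc flip: conj_by_comp)
  next
    fix i w assume i: "0 < i" "i < r" and w: "w \<in> N"
    show "finprod NG (\<lambda>k. conj_by (u i k) w) T = \<one>"
    proof (rule finprod_transversal_eq_one[OF M C.subgroup_axioms C(2,3) M_nofix T(1,2,3) w])
      fix t t' c assume t: "t \<in> T" "t' \<in> T" and c: "c \<in> C" "u i t' = u i t \<otimes> c"
      define Y where "Y = y [^] i"
      have YG: "Y \<in> carrier G" using y(1) by (simp add: Y_def)
      have cG: "c \<in> carrier G" using c C.subset by blast
      note G = TG[OF t(1)] TG[OF t(2)] YG cG
      \<comment> \<open>If the commutators of \<open>t\<close> and \<open>t'\<close> with
        \<open>Y\<close> agree modulo \<open>C\<close>, then \<open>m\<close> commutes with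
        \<open>Y\<close> modulo \<open>C\<close>, which \<open>contra\<close> permits only for
        \<open>m\<close> in \<open>C\<close>.\<close>
      define m where "m = inv t \<otimes> t'"
      have "conj_by t' Y = conj_by t Y \<otimes> inv Y \<otimes> c \<otimes> Y"
        using c(2) G unfolding u_def Y_def[symmetric] by (metis conj_by_closed inv_closed inv_solve_right m_closed)
      then have "conj_by (inv t) (conj_by t' Y) = conj_by (inv t) (conj_by t Y \<otimes> (inv Y \<otimes> c \<otimes> Y))"
        using G by (simp add: m_assoc)
      then have "conj_by m Y = Y \<otimes> conj_by (inv t) (inv Y \<otimes> c \<otimes> Y)"
        using G by (simp add: conj_by_mult m_def conj_by_comp)
      then have "conj_by m Y \<otimes> inv Y = conj_by Y (conj_by (inv t) (inv Y \<otimes> c \<otimes> Y))"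
        using G unfolding conj_by_def[of Y] by simp
      moreover have "conj_by Y (conj_by (inv t) (inv Y \<otimes> c \<otimes> Y)) \<in> C"
        using G c(1) C.inv_op_closed1[of Y c] by (intro normal_conj_by[OF C(1)]) auto
      ultimately have "conj_by m Y \<otimes> inv Y \<in> C" by simp
      moreover have "m \<in> M" using t T(1) M by (auto simp: m_def intro!: subgroup.m_closed subgroup.m_inv_closed)
      ultimately have "m \<in> C" using contra i unfolding Y_def by blast
      moreover have "t \<otimes> m = t'" using G by (simp add: m_def)
      ultimately show "t = t'" using T(3)[of t m] t by simp
    qed (use uM in auto)
  qed (use v in auto)
  then show False using pow_transversal_eq_one v T(4) by blast
qed

text \<open>Otherwise every \<open>k \<otimes> w1\<close> with \<open>k\<close> in
  \<open>T = cyc G w2\<close> acts without fixed points. For \<open>0 < i < t\<close> the map taking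
  \<open>k\<close> to \<open>k [^] i\<close> permutes \<open>T\<close>, and a product over
  \<open>T\<close> is trivial because \<open>w2\<close> fixes it. So \<open>pow_card_eq_one\<close>
  gives \<open>v [^] card T = \<one>\<close>, where \<open>card T\<close> is prime to
  \<open>p\<close>.\<close>

lemma commuting_prime_order_in_cyc:
  assumes w: "w1 \<in> carrier G" "w2 \<in> carrier G" "w1 \<otimes> w2 = w2 \<otimes> w1"
    and t: "prime (t::nat)" "w1 [^] t = \<one>" "w2 [^] t = \<one>" and nt: "w2 \<noteq> \<one>"
    and fpf: "\<And>(i::nat) (j::nat). w1 [^] i \<otimes> w2 [^] j \<noteq> \<one> \<Longrightarrow> acts_fpf N (w1 [^] i \<otimes> w2 [^] j)"
  shows "w1 \<in> cyc G w2"
proof (rule ccontr)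
  assume contra: "w1 \<notin> cyc G w2"
  define T where "T = cyc G w2"
  have T: "subgroup T G" unfolding T_def using w(2) by (rule cyc_subgroup)
  have memT: "k \<in> T \<longleftrightarrow> (\<exists>j::nat. k = w2 [^] j)" for k
    unfolding T_def by (rule mem_cyc_iff[OF w(2) fin])
  note TG = subgroup.mem_carrier[OF T]
  have fT: "finite T" using subgroup.subset[OF T] fin by (meson finite_subset)
  have w2T: "w2 \<in> T" using memT[of w2] w(2) nat_pow_eone by metis
  have fpf2: "acts_fpf N w2" using fpf[of 0 1] w nt by simp
  have tp: "t \<noteq> p" using prime_order_fpf_neq[OF w(2) t(3,1) fpf2] .
  have Tpow: "k [^] t = \<one>" if "k \<in> T" for k
    using that w(2) t(3) by (auto simp: memT nat_pow_pow mult.commute[of _ t]) (simp flip: nat_pow_pow)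
  have comT: "k \<otimes> w1 = w1 \<otimes> k" if "k \<in> T" for k
    using that commute_pow[OF w(3,1,2), of 1] w(1) by (auto simp: memT)
  have Tcom: "k \<otimes> k' = k' \<otimes> k" if "k \<in> T" "k' \<in> T" for k k'
    using that w(2) by (auto simp: memT nat_pow_mult add.commute)
  have dvdT: "\<not> p dvd card T"
  proof
    assume "p dvd card T"
    interpret T: group "G\<lparr>carrier := T\<rparr>" using T by (rule subgroup_imp_group)
    obtain x where "x \<in> T" "x \<noteq> \<one>" "x [^] p = \<one>"
      using T.exists_prime_order[of p] fT p \<open>p dvd card T\<close> by (auto simp: order_def simp flip: nat_pow_consistent)
    then show False using pow_eq_one_coprime[of x t p] Tpow TG p t(1) tp by (simp add: primes_coprime)
  qed
  obtain v where v: "v \<in> N" "v \<noteq> \<one>"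
    using N_nontriv subgroup.one_closed[OF N_subgroup] by blast
  have "v [^] card T = \<one>"
  proof (rule pow_card_eq_one[where z = "\<lambda>k. k \<otimes> w1" and u = "\<lambda>i k. k [^] i" and y = w1 and r = t, OF fT w(1)])
    show "0 < t" using prime_gt_0_nat[OF t(1)] .
    fix k assume k: "k \<in> T"
    show "k \<otimes> w1 \<in> carrier G" using k TG w by simp
    have ne: "k \<otimes> w1 \<noteq> \<one>"
    proof
      assume "k \<otimes> w1 = \<one>"
      then have "w1 = inv k" using k TG w by (metis inv_equality inv_inv)
      then show False using contra k subgroup.m_inv_closed[OF T] by (simp add: T_def)
    qed
    obtain j :: nat where "k = w2 [^] j" using k memT by blast
    then show "acts_fpf N (k \<otimes> w1)" using fpf[of 1 j] ne comT[OF k] w by simp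
    have pw: "(k \<otimes> w1) [^] i = k [^] i \<otimes> w1 [^] i" for i :: nat
      using comT[OF k] TG[OF k] w(1) by (rule pow_mult_distrib)
    show "conj_by ((k \<otimes> w1) [^] t) v = v" if "v \<in> N" for v
      using that N_carrier by (simp add: pw Tpow[OF k] t(2))
    show "conj_by (k [^] (0::nat)) v = v" if "v \<in> N" for v using that N_carrier by simp
    fix i :: nat
    show "k [^] i \<in> carrier G" using TG[OF k] by simp
    show "conj_by ((k \<otimes> w1) [^] i) v = conj_by (k [^] i) (conj_by (w1 [^] i) v)" if "v \<in> N" for v
      using that N_carrier TG[OF k] w(1) by (simp add: pw conj_by_comp)
  next
    fix i w assume i: "0 < i" "i < t" and wN: "w \<in> N"
    show "finprod NG (\<lambda>k. conj_by (k [^] i) w) T = \<one>"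
    proof (rule finprod_transversal_eq_one[OF T, where C = "{\<one>}"])
      show "subgroup {\<one>} G" using normal_imp_subgroup[OF one_is_normal] .
      show "v = \<one>" if "v \<in> N" "\<And>m. m \<in> T \<Longrightarrow> m \<otimes> v = v \<otimes> m" for v
        using that w2T fpf2 unfolding acts_fpf_def by blast
      show "k [^] i \<in> T" if "k \<in> T" for k
        using that w(2) by (auto simp: memT nat_pow_pow)
      show "k = k'" if k: "k \<in> T" "k' \<in> T" "c \<in> {\<one>}" "k' [^] i = k [^] i \<otimes> c" for k k' c
      proof -
        have G: "k \<in> carrier G" "k' \<in> carrier G" using k TG by auto
        have ik: "inv k \<in> T" using k subgroup.m_inv_closed[OF T] by blast
        have pw: "(k' \<otimes> inv k) [^] i = k' [^] i \<otimes> inv (k [^] i)" for i :: nat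
          using pow_mult_distrib[OF Tcom[OF k(2) ik]] G by (simp add: nat_pow_inv)
        have "(k' \<otimes> inv k) [^] i = \<one>" "(k' \<otimes> inv k) [^] t = \<one>"
          unfolding pw using k G Tpow by simp_all
        moreover have "coprime i t"
          using i t(1) nat_dvd_not_less prime_imp_coprime coprime_commute by blast
        ultimately have "k' \<otimes> inv k = \<one>" using pow_eq_one_coprime G by blast
        then show ?thesis using G by (metis inv_equality inv_inv inv_closed)
      qed
    qed (use wN TG N_carrier subgroup.one_closed[OF T] in auto)
  qed (use v in auto)
  then show False using pow_transversal_eq_one v dvdT by blast
qed

text \<open>Apply \<open>frobenius_kernel_action\<close> with \<open>M = cyc G w\<close> and
  \<open>C\<close> trivial: some \<open>h [^] i\<close> with \<open>0 < i < s\<close> commutes with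
  a nontrivial element of \<open>cyc G w\<close>. As \<open>s\<close> and \<open>t\<close> are
  prime, \<open>h\<close> and \<open>w\<close> are powers of these two elements.\<close>

lemma prime_order_normalises_imp_commute:
  assumes h: "h \<in> carrier G" "prime (s::nat)" "h [^] s = \<one>" "h \<noteq> \<one> \<Longrightarrow> acts_fpf N h"
    and w: "w \<in> carrier G" "prime (t::nat)" "w [^] t = \<one>" "w \<noteq> \<one> \<Longrightarrow> acts_fpf N w"
    and nrm: "conj_by h w \<in> cyc G w"
  shows "h \<otimes> w = w \<otimes> h"
proof (rule ccontr)
  assume nc: "h \<otimes> w \<noteq> w \<otimes> h"
  then have ne: "h \<noteq> \<one>" "w \<noteq> \<one>" using h(1) w(1) by auto
  define M where "M = cyc G w"
  have M: "subgroup M G" unfolding M_def using w(1) by (rule cyc_subgroup)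
  have memM: "k \<in> M \<longleftrightarrow> (\<exists>j::nat. k = w [^] j)" for k
    unfolding M_def by (rule mem_cyc_iff[OF w(1) fin])
  have wM: "w \<in> M" using memM[of w] w(1) nat_pow_eone by metis
  have "\<exists>i m. 0 < i \<and> i < s \<and> m \<in> M - {\<one>} \<and> conj_by m (h [^] i) \<otimes> inv (h [^] i) \<in> {\<one>}"
  proof (rule frobenius_kernel_action[OF M one_is_normal _ _ _ w(2)])
    show "t \<noteq> p" using prime_order_fpf_neq[OF w(1,3,2)] w(4) ne by blast
    show "conj_by h m \<in> M" if m: "m \<in> M" for m
    proof -
      obtain j :: nat where "m = w [^] j" using m memM by blast
      moreover obtain i :: nat where "conj_by h w = w [^] i" using nrm memM by (auto simp: M_def)
      ultimately have "conj_by h m = w [^] (i * j)" using h(1) w(1) by (simp add: conj_by_pow nat_pow_pow)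
      then show ?thesis using memM by blast
    qed
    show "v = \<one>" if "v \<in> N" "\<And>m. m \<in> M \<Longrightarrow> m \<otimes> v = v \<otimes> m" for v
      using that wM w(4) ne unfolding acts_fpf_def by blast
    show "m [^] t \<in> {\<one>}" if "m \<in> M" for m
      using that w(1,3) by (auto simp: memM nat_pow_pow mult.commute[of _ t]) (simp flip: nat_pow_pow)
    show "0 < s" using prime_gt_0_nat[OF h(2)] .
    show "{\<one>} \<subseteq> M" using subgroup.one_closed[OF M] by simp
  qed (use h ne N_carrier in auto)
  then obtain i :: nat and m where i: "0 < i" "i < s" and m: "m \<in> M" "m \<noteq> \<one>"
    and "conj_by m (h [^] i) \<otimes> inv (h [^] i) = \<one>" by blast
  moreover have mG: "m \<in> carrier G" using m subgroup.mem_carrier[OF M] by blast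
  ultimately have "conj_by m (h [^] i) = h [^] i" using h(1) by (metis conj_by_closed inv_closed inv_equality inv_inv nat_pow_closed)
  then have cm: "m \<otimes> h [^] i = h [^] i \<otimes> m" using mG h(1) by (simp add: conj_by_fix_iff)
  obtain j :: nat where j: "m = w [^] j" using m memM by blast
  then obtain a :: nat where a: "w = m [^] a" using pow_prime_gen[OF w(1,3,2)] m by blast
  have "h [^] i \<noteq> \<one>"
    using pow_eq_one_coprime[OF h(1) _ h(3)] ne i h(2) nat_dvd_not_less prime_imp_coprime coprime_commute by blast
  then obtain b :: nat where b: "h = (h [^] i) [^] b" using pow_prime_gen[OF h(1,3,2)] by blast
  have "w \<otimes> h = h \<otimes> w" using commute_pow[OF cm mG, of a b] h(1) a b by simp
  then show False using nc by simp
qed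

end

section \<open>Abelian sections of soluble groups\<close>

context group
begin

lemma conj_by_derived:
  assumes D: "D \<subseteq> carrier G" and h: "h \<in> carrier G" and inv: "\<And>d. d \<in> D \<Longrightarrow> conj_by h d \<in> D"
    and x: "x \<in> derived G D"
  shows "conj_by h x \<in> derived G D"
proof -
  have "derived_set G D \<subseteq> carrier G" using D by (rule derived_set_in_carrier)
  then have gen: "y \<in> carrier G" if "y \<in> generate G (derived_set G D)" for y
    using that generate_in_carrier by blast
  from x show ?thesis unfolding derived_def
  proof (induction x rule: generate.induct)
    case one
    show ?case using h generate.one by simp
  next
    case (incl y)
    then obtain a b where ab: "a \<in> D" "b \<in> D" "y = a \<otimes> b \<otimes> inv a \<otimes> inv b" by blast
    have "a \<in> carrier G" "b \<in> carrier G" using ab D by auto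
    then have "conj_by h y = conj_by h a \<otimes> conj_by h b \<otimes> inv (conj_by h a) \<otimes> inv (conj_by h b)"
      using h unfolding ab(3) by (simp add: conj_by_mult conj_by_inv)
    then show ?case using ab inv by (intro generate.incl) blast
  next
    case (inv y)
    then obtain a b where ab: "a \<in> D" "b \<in> D" "y = a \<otimes> b \<otimes> inv a \<otimes> inv b" by blast
    have G: "a \<in> carrier G" "b \<in> carrier G" using ab D by auto
    then have "conj_by h y = conj_by h a \<otimes> conj_by h b \<otimes> inv (conj_by h a) \<otimes> inv (conj_by h b)"
      using h unfolding ab(3) by (simp add: conj_by_mult conj_by_inv)
    then have "conj_by h y \<in> derived_set G D" using ab \<open>\<And>d. d \<in> D \<Longrightarrow> conj_by h d \<in> D\<close> by blast
    moreover have "conj_by h (inv y) = inv (conj_by h y)" using h G ab(3) by (simp add: conj_by_inv)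
    ultimately show ?case by (simp add: generate.inv)
  next
    case (eng x y)
    then show ?case using h gen by (simp add: conj_by_mult generate.eng)
  qed
qed

text \<open>Let \<open>D k\<close> be the last term of the derived series of \<open>E\<close> that
  is not contained in \<open>A\<close>. Its image in \<open>E/A\<close> is abelian, and
  \<open>B\<close> is the preimage of the \<open>t\<close>-torsion of that image; it is preserved by
  \<open>H\<close> because each \<open>D n\<close> is. The lemma serves for \<open>N\<close> itself,
  for the section above its centralizer, and inside a freely acting group.\<close>

lemma exists_abelian_section:
  assumes fin: "finite (carrier G)" and sol: "solvable G"
    and A: "subgroup A G" and E: "subgroup E G" "A \<subset> E"
    and AE: "\<And>e a. e \<in> E \<Longrightarrow> a \<in> A \<Longrightarrow> conj_by e a \<in> A"
    and H: "H \<subseteq> carrier G" "\<And>h a. h \<in> H \<Longrightarrow> a \<in> A \<Longrightarrow> conj_by h a \<in> A"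
      "\<And>h e. h \<in> H \<Longrightarrow> e \<in> E \<Longrightarrow> conj_by h e \<in> E"
  obtains B t where "subgroup B G" "A \<subset> B" "B \<subseteq> E" "\<And>h b. h \<in> H \<Longrightarrow> b \<in> B \<Longrightarrow> conj_by h b \<in> B"
    "\<And>a b. a \<in> B \<Longrightarrow> b \<in> B \<Longrightarrow> a \<otimes> b \<otimes> inv a \<otimes> inv b \<in> A"
    "prime (t::nat)" "\<And>b. b \<in> B \<Longrightarrow> b [^] t \<in> A"
proof -
  note EG = subgroup.mem_carrier[OF E(1)] and AG = subgroup.mem_carrier[OF A]
  define D where "D n = (derived G ^^ n) E" for n
  have sub: "subgroup (D n) G" for n
    unfolding D_def using E(1) by (rule exp_of_derived_is_subgroup)
  have D_Suc: "D (Suc n) = derived G (D n)" for n by (simp add: D_def)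
  have DE: "D n \<subseteq> E" for n
  proof (induction n)
    case (Suc n)
    then show ?case using derived_incl[OF subset_refl sub[of n]] by (auto simp: D_Suc)
  qed (simp add: D_def)
  have DH: "conj_by h d \<in> D n" if "h \<in> H" "d \<in> D n" for h d n
    using that(2)
  proof (induction n arbitrary: d)
    case 0
    then show ?case using H(3) that(1) by (simp add: D_def)
  next
    case (Suc n)
    then show ?case unfolding D_Suc
      using that(1) H(1) subgroup.subset[OF sub] by (intro conj_by_derived) auto
  qed
  obtain n0 where "(derived G ^^ n0) E = {\<one>}"
    using solvable_imp_trivial_derived_seq[OF solvable_subgroup[OF E(1) sol]] by blast
  then have "D n0 \<subseteq> A" using subgroup.one_closed[OF A] by (simp add: D_def)
  define n where "n = (LEAST n. D n \<subseteq> A)"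
  have nA: "D n \<subseteq> A" unfolding n_def using \<open>D n0 \<subseteq> A\<close> by (rule LeastI)
  have "n \<noteq> 0"
  proof
    assume "n = 0"
    then show False using nA E(2) by (simp add: D_def)
  qed
  then obtain k where k: "n = Suc k" using not0_implies_Suc by blast
  then have kA: "\<not> D k \<subseteq> A" using not_less_Least[of k "\<lambda>n. D n \<subseteq> A"] n_def by simp
  have DD: "a \<otimes> b \<otimes> inv a \<otimes> inv b \<in> A" if "a \<in> D k" "b \<in> D k" for a b
  proof -
    have "a \<otimes> b \<otimes> inv a \<otimes> inv b \<in> derived G (D k)"
      unfolding derived_def using that by (intro generate.incl) blast
    then show ?thesis using nA by (auto simp: k D_Suc)
  qed
  have nE: "A \<lhd> (G\<lparr>carrier := E\<rparr>)"
  proof -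
    interpret E: group "G\<lparr>carrier := E\<rparr>" using E(1) by (rule subgroup_imp_group)
    show ?thesis
      using AE subgroup_incl[OF A E(1)] E(2) m_inv_consistent[OF E(1)]
      by (auto simp: E.normal_inv_iff conj_by_def)
  qed
  interpret Q: group "(G\<lparr>carrier := E\<rparr>) Mod A" using nE by (rule normal.factorgroup_is_group)
  let ?Q = "(G\<lparr>carrier := E\<rparr>) Mod A"
  define f where "f e = A #> e" for e
  have f_hom: "f x \<otimes>\<^bsub>?Q\<^esub> f y = f (x \<otimes> y)" if "x \<in> E" "y \<in> E" for x y
    using normal.rcos_sum[OF nE, of x y] that by (simp add: f_def)
  have f_carrier: "f x \<in> carrier ?Q" if "x \<in> E" for x
    using that by (auto simp: carrier_FactGroup f_def)
  have f_one: "f x = \<one>\<^bsub>?Q\<^esub> \<longleftrightarrow> x \<in> A" if "x \<in> E" for x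
    using that EG coset_join1[OF _ _ A, of x] coset_join2[OF _ A, of x] subgroup.subset[OF A]
    by (auto simp: f_def)
  have f_pow: "f x [^]\<^bsub>?Q\<^esub> m = f (x [^] m)" if "x \<in> E" for x and m :: nat
    using normal.FactGroup_pow[OF nE, of x m] that by (simp add: f_def flip: nat_pow_consistent)
  \<comment> \<open>With the quotient operations kept folded, the group laws of \<open>?Q\<close>
    apply to the images under \<open>f\<close>.\<close>
  note [simp del] = mult_FactGroup one_FactGroup
  have f_inv: "f (inv x) = inv\<^bsub>?Q\<^esub> f x" if "x \<in> E" for x
  proof (rule Q.inv_equality[symmetric])
    show "f (inv x) \<otimes>\<^bsub>?Q\<^esub> f x = \<one>\<^bsub>?Q\<^esub>"
      using that f_hom[of "inv x" x] subgroup.m_inv_closed[OF E(1)] EG f_one[of \<one>] subgroup.one_closed[OF A] subgroup.one_closed[OF E(1)] by simp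
  qed (use that f_carrier subgroup.m_inv_closed[OF E(1)] in auto)
  have f_com: "f a \<otimes>\<^bsub>?Q\<^esub> f b = f b \<otimes>\<^bsub>?Q\<^esub> f a" if "a \<in> D k" "b \<in> D k" for a b
  proof -
    have ab: "a \<in> E" "b \<in> E" using that DE by auto
    have "a \<otimes> b = (a \<otimes> b \<otimes> inv a \<otimes> inv b) \<otimes> (b \<otimes> a)"
      using ab EG by (simp add: m_assoc)
    then have "f (a \<otimes> b) = f (a \<otimes> b \<otimes> inv a \<otimes> inv b) \<otimes>\<^bsub>?Q\<^esub> f (b \<otimes> a)"
      using f_hom[of "a \<otimes> b \<otimes> inv a \<otimes> inv b" "b \<otimes> a"] ab E(1)
      by (metis subgroup.m_closed subgroup.m_inv_closed)
    also have "f (a \<otimes> b \<otimes> inv a \<otimes> inv b) = \<one>\<^bsub>?Q\<^esub>"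
      using DD[OF that] E(2) by (subst f_one) auto
    finally have "f (a \<otimes> b) = f (b \<otimes> a)"
      using ab f_carrier[of "b \<otimes> a"] subgroup.m_closed[OF E(1)] Q.l_one by simp
    then show ?thesis using ab by (simp add: f_hom)
  qed
  obtain d where d: "d \<in> D k" "d \<notin> A" using kA by blast
  then have dE: "d \<in> E" using DE by blast
  have finQ: "finite (carrier ?Q)"
    using finite_subset[OF subgroup.subset[OF E(1)] fin] by (simp add: carrier_FactGroup)
  obtain j t :: nat where t: "prime t" and j: "f d [^]\<^bsub>?Q\<^esub> j \<noteq> \<one>\<^bsub>?Q\<^esub>" "(f d [^]\<^bsub>?Q\<^esub> j) [^]\<^bsub>?Q\<^esub> t = \<one>\<^bsub>?Q\<^esub>"
    using Q.exists_prime_pow[OF f_carrier[OF dE] _ finQ] f_one[OF dE] d(2) by blast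
  \<comment> \<open>A power of \<open>d\<close> that has prime order \<open>t\<close> modulo
    \<open>A\<close>; it witnesses below that \<open>B\<close> is larger than
    \<open>A\<close>.\<close>
  define e where "e = d [^] j"
  have eD: "e \<in> D k" unfolding e_def using d(1) sub[of k] by (induction j) (auto intro: subgroup.m_closed subgroup.one_closed)
  have eE: "e \<in> E" using eD DE by blast
  have e: "e \<notin> A" "e [^] t \<in> A"
  proof -
    have etE: "e [^] t \<in> E" using eE E(1) by (induction t) (auto intro: subgroup.m_closed subgroup.one_closed)
    show "e \<notin> A" using j(1) f_pow[OF dE, of j] f_one[OF eE] by (simp add: e_def)
    show "e [^] t \<in> A" using j(2) f_pow[OF dE, of j] f_pow[OF eE, of t] f_one[OF etE] by (simp add: e_def)
  qed
  define B where "B = {b \<in> E. f b \<in> f ` D k \<and> f b [^]\<^bsub>?Q\<^esub> t = \<one>\<^bsub>?Q\<^esub>}"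
  have powE: "x [^] m \<in> E" if "x \<in> E" for x and m :: nat
    using that E(1) by (induction m) (auto intro: subgroup.m_closed subgroup.one_closed)
  have B_com: "f a \<otimes>\<^bsub>?Q\<^esub> f b = f b \<otimes>\<^bsub>?Q\<^esub> f a" if "a \<in> B" "b \<in> B" for a b
    using that f_com by (auto simp: B_def)
  have "subgroup B G"
  proof (rule subgroupI)
    show "B \<subseteq> carrier G" using EG by (auto simp: B_def)
    have "e \<in> B" using eE eD e f_pow[OF eE] f_one[OF powE[OF eE]] by (auto simp: B_def)
    then show "B \<noteq> {}" by blast
    fix a assume a: "a \<in> B"
    then obtain x where x: "x \<in> D k" "f a = f x" by (auto simp: B_def)
    have aE: "a \<in> E" using a by (simp add: B_def)
    have xE: "x \<in> E" using x(1) DE by blast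
    have "f (inv a) = f (inv x)" using f_inv[OF aE] f_inv[OF xE] x(2) by simp
    moreover have "inv x \<in> D k" using x sub by (simp add: subgroup.m_inv_closed)
    moreover have "f (inv a) [^]\<^bsub>?Q\<^esub> t = \<one>\<^bsub>?Q\<^esub>"
      using a f_inv[OF aE] f_carrier[OF aE] by (simp add: B_def Q.nat_pow_inv)
    ultimately show "inv a \<in> B" using aE E(1) by (auto simp: B_def subgroup.m_inv_closed)
    fix b assume b: "b \<in> B"
    then obtain y where y: "y \<in> D k" "f b = f y" by (auto simp: B_def)
    have bE: "b \<in> E" using b by (simp add: B_def)
    have fab: "f (a \<otimes> b) = f a \<otimes>\<^bsub>?Q\<^esub> f b" using aE bE f_hom by simp
    moreover have yE: "y \<in> E" using y(1) DE by blast
    ultimately have "f (a \<otimes> b) = f (x \<otimes> y)" using x(2) y(2) f_hom[OF xE yE] by simp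
    moreover have "x \<otimes> y \<in> D k" using x y sub by (simp add: subgroup.m_closed)
    moreover have "f (a \<otimes> b) [^]\<^bsub>?Q\<^esub> t = \<one>\<^bsub>?Q\<^esub>"
      unfolding fab using Q.pow_mult_distrib[OF B_com[OF a b] f_carrier[OF aE] f_carrier[OF bE]] a b
      by (simp add: B_def)
    ultimately show "a \<otimes> b \<in> B" using aE bE E(1) by (auto simp: B_def subgroup.m_closed)
  qed
  moreover have "A \<subset> B"
  proof
    show "A \<subseteq> B"
    proof
      fix a assume a: "a \<in> A"
      then have aE: "a \<in> E" using E(2) by blast
      have "\<one> \<in> D k" using sub by (rule subgroup.one_closed)
      moreover have "f a = f \<one>" using f_one[OF aE] f_one[of \<one>] a subgroup.one_closed[OF A] subgroup.one_closed[OF E(1)] by simp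
      moreover have "f a = \<one>\<^bsub>?Q\<^esub>" using f_one[OF aE] a by blast
      moreover have "f a [^]\<^bsub>?Q\<^esub> t = \<one>\<^bsub>?Q\<^esub>" using \<open>f a = \<one>\<^bsub>?Q\<^esub>\<close> by (simp only: Q.nat_pow_one)
      ultimately show "a \<in> B" using aE unfolding B_def by blast
    qed
    have "e \<in> B" using eE eD e f_pow[OF eE] f_one[OF powE[OF eE]] by (auto simp: B_def)
    then show "A \<noteq> B" using e(1) by blast
  qed
  moreover have "B \<subseteq> E" by (auto simp: B_def)
  moreover have "conj_by h b \<in> B" if h: "h \<in> H" and b: "b \<in> B" for h b
  proof -
    obtain x where x: "x \<in> D k" "f b = f x" using b by (auto simp: B_def)
    have E': "b \<in> E" "x \<in> E" using b x DE by (auto simp: B_def)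
    have G: "h \<in> carrier G" "b \<in> carrier G" "x \<in> carrier G" using h H(1) E' EG by auto
    have cE: "conj_by h b \<in> E" "conj_by h x \<in> E" using h E' H(3) by auto
    \<comment> \<open>\<open>b\<close> and \<open>x\<close> lie in one coset of \<open>A\<close>,
      hence so do their conjugates by \<open>h\<close>; and \<open>conj_by h x\<close> is again in
      \<open>D k\<close>.\<close>
    have "f (b \<otimes> inv x) = \<one>\<^bsub>?Q\<^esub>"
      using E' x f_hom[of b "inv x"] f_inv[of x] f_carrier[of x] subgroup.m_inv_closed[OF E(1)] by simp
    then have "b \<otimes> inv x \<in> A" using f_one[of "b \<otimes> inv x"] E' E(1) by (simp add: subgroup.m_closed subgroup.m_inv_closed)
    then have cA: "conj_by h b \<otimes> inv (conj_by h x) \<in> A"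
      using H(2)[OF h] G by (simp add: conj_by_mult flip: conj_by_inv) (metis conj_by_mult inv_closed)
    then have "f (conj_by h b) = f (conj_by h b \<otimes> inv (conj_by h x)) \<otimes>\<^bsub>?Q\<^esub> f (conj_by h x)"
      using cE E G by (subst f_hom) (auto simp: m_assoc)
    also have "\<dots> = f (conj_by h x)"
    proof -
      have "f (conj_by h b \<otimes> inv (conj_by h x)) = \<one>\<^bsub>?Q\<^esub>" using cA E(2) f_one by blast
      then show ?thesis using f_carrier[OF cE(2)] by simp
    qed
    finally have "f (conj_by h b) \<in> f ` D k" using DH[OF h x(1)] by blast
    moreover have "f (conj_by h b) [^]\<^bsub>?Q\<^esub> t = \<one>\<^bsub>?Q\<^esub>"
    proof -
      have "b [^] t \<in> A" using b f_pow[of b t] f_one[OF powE[of b t]] by (simp add: B_def)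
      then have "conj_by h b [^] t \<in> A" using H(2)[OF h] G by (simp flip: conj_by_pow)
      then show ?thesis using f_pow[OF cE(1), of t] f_one[OF powE[OF cE(1), of t]] by simp
    qed
    ultimately show ?thesis using cE by (simp add: B_def)
  qed
  moreover have "a \<otimes> b \<otimes> inv a \<otimes> inv b \<in> A" if a: "a \<in> B" and b: "b \<in> B" for a b
  proof -
    have ab: "a \<in> E" "b \<in> E" using a b by (auto simp: B_def)
    have iE: "inv a \<in> E" "inv b \<in> E" "a \<otimes> b \<in> E" "b \<otimes> a \<in> E" "inv (b \<otimes> a) \<in> E" "a \<otimes> b \<otimes> inv (b \<otimes> a) \<in> E"
      using ab E(1) by (auto intro!: subgroup.m_closed subgroup.m_inv_closed)
    have "f (a \<otimes> b \<otimes> inv (b \<otimes> a)) = f (a \<otimes> b) \<otimes>\<^bsub>?Q\<^esub> inv\<^bsub>?Q\<^esub> f (b \<otimes> a)"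
      using f_hom[OF iE(3,5)] f_inv[OF iE(4)] by simp
    also have "f (a \<otimes> b) = f (b \<otimes> a)" using B_com[OF a b] ab f_hom by simp
    also have "\<dots> \<otimes>\<^bsub>?Q\<^esub> inv\<^bsub>?Q\<^esub> f (b \<otimes> a) = \<one>\<^bsub>?Q\<^esub>" using iE f_carrier by simp
    finally have "a \<otimes> b \<otimes> inv (b \<otimes> a) \<in> A" using f_one iE by simp
    then show ?thesis using ab EG by (simp add: inv_mult_group m_assoc)
  qed
  moreover have "b [^] t \<in> A" if "b \<in> B" for b
    using that f_pow[of b t] f_one[OF powE[of b t]] by (simp add: B_def)
  ultimately show ?thesis using t that by blast
qed

end

section \<open>Groups acting without fixed points\<close>

context group
begin

definition centralizer :: "'a set \<Rightarrow> 'a set" where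
  "centralizer U = {g \<in> carrier G. \<forall>x\<in>U. g \<otimes> x = x \<otimes> g}"

lemma centralizer_subgroup:
  assumes U: "U \<subseteq> carrier G"
  shows "subgroup (centralizer U) G"
proof (rule subgroupI)
  show "centralizer U \<noteq> {}" using U by (auto simp: centralizer_def subset_iff intro!: exI[of _ \<one>])
  fix a assume a: "a \<in> centralizer U"
  then have aG: "a \<in> carrier G" by (simp add: centralizer_def)
  have "inv a \<otimes> x = x \<otimes> inv a" if "x \<in> U" for x
  proof -
    have xG: "x \<in> carrier G" using that U by blast
    have "conj_by a x = x" using a that aG xG by (simp add: conj_by_fix_iff centralizer_def)
    then have "conj_by (inv a) x = x" using aG xG by (metis conj_by_inv_cancel(2))
    then show ?thesis using aG xG by (simp add: conj_by_fix_iff)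
  qed
  then show "inv a \<in> centralizer U" using aG by (simp add: centralizer_def)
  fix b assume b: "b \<in> centralizer U"
  then have bG: "b \<in> carrier G" by (simp add: centralizer_def)
  have "a \<otimes> b \<otimes> x = x \<otimes> (a \<otimes> b)" if "x \<in> U" for x
  proof -
    have xG: "x \<in> carrier G" using that U by blast
    have "a \<otimes> (b \<otimes> x) = (a \<otimes> x) \<otimes> b" using b that aG bG xG by (simp add: centralizer_def m_assoc)
    also have "\<dots> = x \<otimes> (a \<otimes> b)" using a that aG bG xG by (simp add: centralizer_def m_assoc)
    finally show ?thesis using aG bG xG by (simp add: m_assoc)
  qed
  then show "a \<otimes> b \<in> centralizer U" using aG bG by (simp add: centralizer_def)
qed (auto simp: centralizer_def)

lemma subgroup_pow_closed: "subgroup A G \<Longrightarrow> x \<in> A \<Longrightarrow> x [^] (n::nat) \<in> A"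
  by (induction n) (simp_all add: subgroup.one_closed subgroup.m_closed)

lemma subgroup_pow_coprime:
  assumes A: "subgroup A G" and x: "x \<in> carrier G" "x [^] (m::nat) \<in> A" "x [^] (n::nat) \<in> A"
    and c: "coprime m n" "m \<noteq> 0"
  shows "x \<in> A"
proof -
  obtain a b where ab: "m * a = n * b + 1" using bezout_nat[of m n] c by auto
  have "(x [^] m) [^] a = x [^] (n * b + 1)" using x(1) by (simp only: nat_pow_pow ab)
  also have "\<dots> = (x [^] n) [^] b \<otimes> x" using x(1) by (simp add: nat_pow_pow)
  finally have "x = inv ((x [^] n) [^] b) \<otimes> (x [^] m) [^] a" using x(1) by simp
  then show ?thesis
    using subgroup.m_closed[OF A] subgroup.m_inv_closed[OF A] subgroup_pow_closed[OF A] x by metis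
qed

text \<open>Each time an \<open>a\<close> moves to the left past a \<open>b\<close>, a factor
  \<open>z\<close> arises, and \<open>z\<close> commutes with both. Collecting the \<open>a\<close>
  in front takes \<open>n * (n - 1) div 2\<close> such moves.\<close>

lemma pow_mult_class_two:
  assumes G: "a \<in> carrier G" "b \<in> carrier G" "z \<in> carrier G"
    and z: "z \<otimes> a = a \<otimes> z" "z \<otimes> b = b \<otimes> z" "b \<otimes> a = a \<otimes> b \<otimes> z"
  shows "(a \<otimes> b) [^] (n::nat) = a [^] n \<otimes> b [^] n \<otimes> z [^] (n * (n - 1) div 2)"
proof (induction n)
  case (Suc n)
  have zb: "z [^] i \<otimes> b = b \<otimes> z [^] i" for i :: nat
    using commute_pow[OF z(2) G(3,2), of i 1] G by simp
  have za: "z [^] i \<otimes> a = a \<otimes> z [^] i" for i :: nat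
    using commute_pow[OF z(1) G(3,1), of i 1] G by simp
  have bz: "b [^] i \<otimes> z = z \<otimes> b [^] i" for i :: nat
    using commute_pow[OF z(2) G(3,2), of 1 i] G by simp
  have ba: "b [^] i \<otimes> a = a \<otimes> b [^] i \<otimes> z [^] i" for i :: nat
  proof (induction i)
    case (Suc i)
    have "b [^] Suc i \<otimes> a = b [^] i \<otimes> (b \<otimes> a)" using G by (simp add: m_assoc)
    also have "\<dots> = (b [^] i \<otimes> a) \<otimes> (b \<otimes> z)" using G by (simp add: z(3) m_assoc)
    also have "\<dots> = a \<otimes> b [^] i \<otimes> (z [^] i \<otimes> b) \<otimes> z" using G by (simp add: Suc.IH m_assoc)
    also have "\<dots> = a \<otimes> b [^] Suc i \<otimes> z [^] Suc i" using G by (simp add: zb m_assoc)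
    finally show ?case .
  qed (use G in simp)
  define k where "k = n * (n - 1) div 2"
  have k: "Suc n * (Suc n - 1) div 2 = n + k"
    unfolding k_def by (cases n) (simp_all add: algebra_simps)
  have "(a \<otimes> b) [^] Suc n = a [^] n \<otimes> b [^] n \<otimes> z [^] k \<otimes> (a \<otimes> b)"
    using Suc by (simp add: k_def)
  also have "\<dots> = a [^] n \<otimes> b [^] n \<otimes> (z [^] k \<otimes> a) \<otimes> b" using G by (simp add: m_assoc)
  also have "\<dots> = a [^] n \<otimes> (b [^] n \<otimes> a) \<otimes> (z [^] k \<otimes> b)" using G by (simp add: za m_assoc)
  also have "\<dots> = a [^] n \<otimes> a \<otimes> b [^] n \<otimes> (z [^] n \<otimes> b) \<otimes> z [^] k"
    unfolding ba zb[of k] using G by (simp add: m_assoc)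
  also have "\<dots> = a [^] Suc n \<otimes> b [^] Suc n \<otimes> (z [^] n \<otimes> z [^] k)" using G by (simp add: zb m_assoc)
  also have "z [^] n \<otimes> z [^] k = z [^] (Suc n * (Suc n - 1) div 2)" using G by (simp only: k nat_pow_mult)
  finally show ?case .
qed simp

text \<open>For odd \<open>t\<close> the number \<open>t * (t - 1) div 2\<close> is a multiple of
  \<open>t\<close>, so the power of \<open>z\<close> disappears.\<close>

lemma pow_mult_class_two_odd:
  assumes "a \<in> carrier G" "b \<in> carrier G" "z \<in> carrier G"
    and "z \<otimes> a = a \<otimes> z" "z \<otimes> b = b \<otimes> z" "b \<otimes> a = a \<otimes> b \<otimes> z"
    and t: "z [^] (t::nat) = \<one>" "odd t"
  shows "(a \<otimes> b) [^] t = a [^] t \<otimes> b [^] t"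
proof -
  obtain m where m: "t = 2 * m + 1" using t(2) oddE by blast
  have "t * (t - 1) div 2 = t * m" by (simp add: m)
  then have "z [^] (t * (t - 1) div 2) = \<one>"
    using t(1) assms(3) by (simp flip: nat_pow_pow)
  then show ?thesis using pow_mult_class_two[OF assms(1-6), of t] assms by simp
qed

end

section \<open>Freely acting groups without involutions\<close>

context elementary_normal
begin

context
  fixes H
  assumes sol: "solvable G" and H: "subgroup H G"
    and fpf: "\<And>h. h \<in> H \<Longrightarrow> h \<noteq> \<one> \<Longrightarrow> acts_fpf N h"
    and no_inv: "\<And>h. h \<in> H \<Longrightarrow> h \<otimes> h = \<one> \<Longrightarrow> h = \<one>"
begin

lemma H_carrier: "h \<in> H \<Longrightarrow> h \<in> carrier G"
  using H by (rule subgroup.mem_carrier)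

lemma H_prime_order_in_cyc:
  assumes w: "w1 \<in> H" "w2 \<in> H" "w1 \<otimes> w2 = w2 \<otimes> w1"
    and t: "prime (t::nat)" "w1 [^] t = \<one>" "w2 [^] t = \<one>" "w2 \<noteq> \<one>"
  shows "w1 \<in> cyc G w2"
  using w(3) t H_carrier[OF w(1)] H_carrier[OF w(2)] fpf w(1,2) H
  by (intro commuting_prime_order_in_cyc) (auto simp: subgroup_pow_closed subgroup.m_closed)

lemma H_prime_order_commute:
  assumes h: "h \<in> H" "prime (s::nat)" "h [^] s = \<one>"
    and w: "w \<in> H" "prime (t::nat)" "w [^] t = \<one>" "conj_by h w \<in> cyc G w"
  shows "h \<otimes> w = w \<otimes> h"
  using assms H_carrier fpf by (intro prime_order_normalises_imp_commute[of h s w t]) auto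

text \<open>All elements of \<open>H\<close> have odd order, since one of even order has an
  involution among its powers. Hence \<open>h\<close> is a power of its square. This later excludes
  \<open>t = 2\<close>.\<close>

lemma H_odd_order_root:
  assumes h: "h \<in> H" and A: "subgroup A G" "h [^] (2::nat) \<in> A"
  shows "h \<in> A"
proof (cases "even (ord h)")
  case True
  then obtain k where k: "ord h = 2 * k" by blast
  have "ord h > 0" using ord_ge_1[OF fin H_carrier[OF h]] by simp
  then have "h [^] k \<noteq> \<one>" using k by (auto simp: pow_eq_id[OF H_carrier[OF h]] dest: dvd_imp_le)
  moreover have "h [^] k \<otimes> h [^] k = \<one>"
    using H_carrier[OF h] by (simp add: nat_pow_mult pow_eq_id k flip: mult_2)
  ultimately have False using no_inv[of "h [^] k"] subgroup_pow_closed[OF H h] by blast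
  then show ?thesis ..
next
  case False
  then show ?thesis
    using subgroup_pow_coprime[OF A(1) H_carrier[OF h], of 2 "ord h"] A H_carrier[OF h]
    by (simp add: subgroup.one_closed)
qed

text \<open>Otherwise, with \<open>A\<close> the center of the group \<open>E\<close> generated by the elements of prime order, choose \<open>B\<close>
  normal in \<open>H\<close>, with \<open>A < B \<le> E\<close>, abelian and of exponent \<open>t\<close> modulo \<open>A\<close>. Since \<open>B\<close> has at most one
  subgroup of order \<open>t\<close>, the \<open>t\<close>-th power map shows that \<open>B\<close> is a cyclic extension of \<open>A\<close>, hence abelian; and then
  each element of prime order centralizes \<open>B\<close>.\<close>

lemma H_prime_order_elements_commute:
  assumes g: "g \<in> H" "prime (m::nat)" "g [^] m = \<one>" and h: "h \<in> H" "prime (n::nat)" "h [^] n = \<one>"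
  shows "g \<otimes> h = h \<otimes> g"
proof (rule ccontr)
  assume nc: "g \<otimes> h \<noteq> h \<otimes> g"
  define S where "S = {h \<in> H. \<exists>s::nat. prime s \<and> h [^] s = \<one>}"
  define E where "E = generate G S"
  define A where "A = E \<inter> centralizer E"
  have SG: "S \<subseteq> carrier G" using H_carrier by (auto simp: S_def)
  have E: "subgroup E G" unfolding E_def using SG by (rule generate_is_subgroup)
  have EH: "E \<subseteq> H" unfolding E_def using H by (intro generate_subgroup_incl) (auto simp: S_def)
  have SE: "S \<subseteq> E" unfolding E_def by (auto intro: generate.incl)
  note EG = subgroup.mem_carrier[OF E]
  have A: "subgroup A G"
    unfolding A_def using E centralizer_subgroup[OF subgroup.subset[OF E]] by (rule subgroups_Inter_pair)
  have AE: "a \<otimes> e = e \<otimes> a" if "a \<in> A" "e \<in> E" for a e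
    using that by (simp add: A_def centralizer_def)
  have "g \<in> E" "h \<in> E" using g h SE by (auto simp: S_def)
  then have "A \<subset> E" using nc AE unfolding A_def by blast
  have HE: "conj_by h e \<in> E" if "h \<in> H" "e \<in> E" for h e
  proof -
    have hG: "h \<in> carrier G" using that H_carrier by blast
    \<comment> \<open>The elements of \<open>E\<close> that \<open>h\<close> conjugates into
      \<open>E\<close> form a subgroup containing the generators \<open>S\<close>.\<close>
    define E' where "E' = {e \<in> E. conj_by h e \<in> E}"
    have "S \<subseteq> E'"
    proof
      fix u assume u: "u \<in> S"
      then obtain s :: nat where s: "prime s" "u [^] s = \<one>" by (auto simp: S_def)
      have "conj_by h u [^] s = \<one>" using hG u SG s by (subst conj_by_pow[symmetric]) auto
      moreover have "conj_by h u \<in> H"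
        using u that H unfolding conj_by_def S_def by (auto intro!: subgroup.m_closed subgroup.m_inv_closed)
      ultimately have "conj_by h u \<in> S" using s by (auto simp: S_def)
      then show "u \<in> E'" using SE u by (auto simp: E'_def)
    qed
    moreover have "subgroup E' G"
    proof (rule subgroupI)
      show "E' \<subseteq> carrier G" using EG by (auto simp: E'_def)
      show "E' \<noteq> {}" using hG subgroup.one_closed[OF E] by (auto simp: E'_def)
      show "inv a \<in> E'" if "a \<in> E'" for a
        using that EG hG E by (auto simp: E'_def conj_by_inv subgroup.m_inv_closed)
      show "a \<otimes> b \<in> E'" if "a \<in> E'" "b \<in> E'" for a b
        using that EG hG E by (auto simp: E'_def conj_by_mult subgroup.m_closed)
    qed
    ultimately have "E \<subseteq> E'" unfolding E_def by (rule generate_subgroup_incl)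
    then show ?thesis using that by (auto simp: E'_def)
  qed
  have HA: "conj_by h a \<in> A" if "h \<in> H" "a \<in> A" for h a
  proof -
    have G: "h \<in> carrier G" "a \<in> carrier G" "a \<in> E" using that H_carrier EG by (auto simp: A_def)
    have "conj_by h a \<otimes> e = e \<otimes> conj_by h a" if "e \<in> E" for e
    proof -
      have "conj_by (inv h) e \<in> E" using HE[of "inv h" e] that \<open>h \<in> H\<close> H by (simp add: subgroup.m_inv_closed)
      then have "conj_by h (a \<otimes> conj_by (inv h) e) = conj_by h (conj_by (inv h) e \<otimes> a)"
        using AE[OF \<open>a \<in> A\<close>] by simp
      then show ?thesis using G EG[OF that] by (simp add: conj_by_mult)
    qed
    then show ?thesis using HE[OF that(1) G(3)] G by (simp add: A_def centralizer_def)
  qed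
  have EA: "conj_by e a \<in> A" if "e \<in> E" "a \<in> A" for e a using HA that EH by blast
  have HG: "H \<subseteq> carrier G" using H by (rule subgroup.subset)
  obtain B and t :: nat where B: "subgroup B G" "A \<subset> B" "B \<subseteq> E" "\<And>h b. h \<in> H \<Longrightarrow> b \<in> B \<Longrightarrow> conj_by h b \<in> B"
    "\<And>a b. a \<in> B \<Longrightarrow> b \<in> B \<Longrightarrow> a \<otimes> b \<otimes> inv a \<otimes> inv b \<in> A"
    and t: "prime t" "\<And>b. b \<in> B \<Longrightarrow> b [^] t \<in> A"
    by (rule exists_abelian_section[OF fin sol A E \<open>A \<subset> E\<close> _ HG])
      (erule (1) EA, erule (1) HA, erule (1) HE, (rule that; assumption))
  have BH: "b \<in> H" if "b \<in> B" for b using that B(3) EH by blast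
  note BG = subgroup.mem_carrier[OF B(1)]
  have AB: "a \<otimes> b = b \<otimes> a" if "a \<in> A" "b \<in> B" for a b using that AE B(3) by blast
  obtain b0 where b0: "b0 \<in> B" "b0 \<notin> A" using B(2) by blast
  have "t \<noteq> 2" using H_odd_order_root[OF BH[OF b0(1)] A] t(2)[OF b0(1)] b0(2) by blast
  then have odd: "odd t" using t(1) primes_dvd_imp_eq two_is_prime_nat by blast
  \<comment> \<open>The commutator for which
    \<open>b \<otimes> a = a \<otimes> b \<otimes> c a b\<close>. Since \<open>a [^] t\<close> is
    central in \<open>E\<close>, conjugating it by \<open>b\<close> shows
    \<open>c a b [^] t = \<one>\<close>; as \<open>t\<close> is odd, the \<open>t\<close>-th power
    map is then multiplicative on \<open>B\<close>.\<close>
  define c where "c a b = inv b \<otimes> inv a \<otimes> b \<otimes> a" for a b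
  have c: "c a b \<in> A" "b \<otimes> a = a \<otimes> b \<otimes> c a b" "c a b [^] t = \<one>" if ab: "a \<in> B" "b \<in> B" for a b
  proof -
    have G: "a \<in> carrier G" "b \<in> carrier G" using ab BG by auto
    show cA: "c a b \<in> A" using B(5)[of "inv b" "inv a"] ab B(1) G by (simp add: c_def subgroup.m_inv_closed)
    then have cG: "c a b \<in> carrier G" using subgroup.mem_carrier[OF A] by blast
    show eq: "b \<otimes> a = a \<otimes> b \<otimes> c a b" using G by (simp add: c_def m_assoc)
    have "b \<otimes> a = a \<otimes> c a b \<otimes> b"
      using eq AB[OF cA ab(2)] G cG by (simp add: m_assoc)
    then have "conj_by b a = a \<otimes> c a b"
      using G cG unfolding conj_by_def by (subst inv_solve_right') auto
    then have "conj_by b (a [^] t) = a [^] t \<otimes> c a b [^] t"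
      using AB[OF cA ab(1)] G cG by (simp add: conj_by_pow pow_mult_distrib)
    moreover have "conj_by b (a [^] t) = a [^] t"
      using AB[OF t(2)[OF ab(1)] ab(2)] G by (simp add: conj_by_fix_iff)
    ultimately show "c a b [^] t = \<one>" using G cG by simp
  qed
  have pow_hom: "(a \<otimes> b) [^] t = a [^] t \<otimes> b [^] t" if ab: "a \<in> B" "b \<in> B" for a b
    using pow_mult_class_two_odd[of a b "c a b" t] c[OF ab] ab AB BG odd subgroup.mem_carrier[OF A] by blast
  have Bcom: "a \<otimes> b = b \<otimes> a" if ab: "a \<in> B" "b \<in> B" for a b
  proof (rule ccontr)
    assume ne: "a \<otimes> b \<noteq> b \<otimes> a"
    define z where "z = c a b"
    have G: "a \<in> carrier G" "b \<in> carrier G" using ab BG by auto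
    have zA: "z \<in> A" and zt: "z [^] t = \<one>" using c[OF ab] by (auto simp: z_def)
    have zB: "z \<in> B" using zA B(2) by blast
    have z1: "z \<noteq> \<one>" using c(2)[OF ab] G ne by (auto simp: z_def)
    have aA: "a \<notin> A" using AB ab ne by blast
    \<comment> \<open>The kernel of the \<open>t\<close>-th power map from \<open>B\<close> to
      \<open>A\<close>. Its elements commute with the central element \<open>z\<close> of order
      \<open>t\<close>, so by \<open>H_prime_order_in_cyc\<close> they are powers of
      \<open>z\<close>.\<close>
    define K where "K = {k \<in> B. k [^] t = \<one>}"
    have "K \<subseteq> (\<lambda>j. z [^] j) ` {..<t}"
    proof
      fix k assume k: "k \<in> K"
      then have "k \<in> cyc G z"
        using H_prime_order_in_cyc[OF BH BH _ t(1) _ zt z1, of k] AB[OF zA, of k] zB by (auto simp: K_def)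
      then obtain j :: nat where j: "k = z [^] j" using mem_cyc_iff[OF BG[OF zB] fin] by blast
      have "z [^] j = z [^] (t * (j div t) + j mod t)" by simp
      also have "\<dots> = (z [^] t) [^] (j div t) \<otimes> z [^] (j mod t)"
        using BG[OF zB] by (simp only: nat_pow_mult nat_pow_pow nat_pow_closed)
      also have "\<dots> = z [^] (j mod t)" using BG[OF zB] by (simp add: zt)
      finally show "k \<in> (\<lambda>j. z [^] j) ` {..<t}" using j prime_gt_0_nat[OF t(1)] by auto
    qed
    then have Kt: "card K \<le> t"
      using card_mono[of "(\<lambda>j. z [^] j) ` {..<t}" K] card_image_le[of "{..<t}" "\<lambda>j. z [^] j"] by simp
    have fB: "finite B" using subgroup.subset[OF B(1)] fin by (rule finite_subset)
    have fA: "finite A" using fB B(2) finite_subset by blast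
    \<comment> \<open>A nonempty fibre of the power map is contained in a translate of
      \<open>K\<close>; summing over \<open>A\<close> bounds \<open>card B\<close> by
      \<open>card A * t\<close>.\<close>
    have fib: "card {x \<in> B. x [^] t = y} \<le> t" for y
    proof (cases "\<exists>x0\<in>B. x0 [^] t = y")
      case True
      then obtain x0 where x0: "x0 \<in> B" "x0 [^] t = y" by blast
      have "{x \<in> B. x [^] t = y} \<subseteq> (\<lambda>k. x0 \<otimes> k) ` K"
      proof
        fix x assume x: "x \<in> {x \<in> B. x [^] t = y}"
        have ix: "inv x0 \<in> B" using x0 B(1) by (simp add: subgroup.m_inv_closed)
        have xG: "x \<in> carrier G" "x0 \<in> carrier G" using x x0 BG by auto
        have "(inv x0 \<otimes> x) [^] t = inv x0 [^] t \<otimes> x [^] t" using ix x by (intro pow_hom) auto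
        also have "\<dots> = \<one>" using x x0 xG by (auto simp: nat_pow_inv)
        finally have "inv x0 \<otimes> x \<in> K" using ix x B(1) by (simp add: K_def subgroup.m_closed)
        moreover have "x = x0 \<otimes> (inv x0 \<otimes> x)" using xG by simp
        ultimately show "x \<in> (\<lambda>k. x0 \<otimes> k) ` K" by blast
      qed
      moreover have "finite K" using fB by (simp add: K_def)
      ultimately have "card {x \<in> B. x [^] t = y} \<le> card K"
        by (meson card_image_le card_mono finite_imageI le_trans)
      then show ?thesis using Kt by simp
    next
      case False
      then have "{x \<in> B. x [^] t = y} = {}" by blast
      then show ?thesis by (simp only: card.empty le0)
    qed
    have "B = (\<Union>y\<in>A. {x \<in> B. x [^] t = y})" using t(2) by blast
    then have "card B \<le> (\<Sum>y\<in>A. card {x \<in> B. x [^] t = y})"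
      using card_UN_le[OF fA, of "\<lambda>y. {x \<in> B. x [^] t = y}"] by simp
    also have "\<dots> \<le> card A * t"
      using sum_bounded_above[of A "\<lambda>y. card {x \<in> B. x [^] t = y}" t] fib by simp
    finally have cardB: "card B \<le> card A * t" .
    \<comment> \<open>The products \<open>a [^] j \<otimes> e\<close> with \<open>j < t\<close> and
      \<open>e\<close> in \<open>A\<close> are \<open>card A * t\<close> distinct elements, so they
      exhaust \<open>B\<close>. Hence \<open>b\<close> is one of them and commutes with
      \<open>a\<close>.\<close>
    define f where "f = (\<lambda>(j, e). a [^] (j::nat) \<otimes> e)"
    have no: "a [^] d \<notin> A" if "0 < d" "d < t" for d :: nat
    proof
      assume "a [^] d \<in> A"
      moreover have "coprime d t"
        using that t(1) nat_dvd_not_less prime_imp_coprime coprime_commute by blast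
      ultimately show False using subgroup_pow_coprime[OF A G(1) _ t(2)[OF ab(1)]] aA \<open>0 < d\<close> by blast
    qed
    have step: False if "i < j" "j < t" "e \<in> A" "e' \<in> A" "a [^] i \<otimes> e = a [^] j \<otimes> e'" for i j :: nat and e e'
    proof -
      have eG: "e \<in> carrier G" "e' \<in> carrier G" using that subgroup.mem_carrier[OF A] by auto
      have "a [^] j = a [^] i \<otimes> a [^] (j - i)" using that(1) G(1) by (simp add: nat_pow_mult)
      then have "a [^] i \<otimes> e = a [^] i \<otimes> (a [^] (j - i) \<otimes> e')" using that(5) eG G(1) by (simp add: m_assoc)
      then have "e = a [^] (j - i) \<otimes> e'" using eG G(1) by simp
      then have "a [^] (j - i) = e \<otimes> inv e'" using eG G(1) by (simp add: inv_solve_right)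
      then have "a [^] (j - i) \<in> A" using that A by (simp add: subgroup.m_closed subgroup.m_inv_closed)
      then show False using no[of "j - i"] that by (simp add: less_imp_diff_less)
    qed
    have "inj_on f ({..<t} \<times> A)"
    proof (rule inj_onI)
      fix x y assume xy: "x \<in> {..<t} \<times> A" "y \<in> {..<t} \<times> A" "f x = f y"
      then obtain i e j e' where ij: "x = (i, e)" "y = (j, e')" "i < t" "j < t" "e \<in> A" "e' \<in> A"
        by auto
      then have eq: "a [^] i \<otimes> e = a [^] j \<otimes> e'" using xy(3) by (simp add: f_def)
      have "i = j" using step[of i j e e'] step[of j i e' e] eq ij by (metis linorder_neqE_nat)
      then show "x = y" using eq ij G(1) subgroup.mem_carrier[OF A] by simp
    qed
    then have "card (f ` ({..<t} \<times> A)) = card A * t" by (simp add: card_image card_cartesian_product)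
    moreover have "f ` ({..<t} \<times> A) \<subseteq> B"
      using ab(1) B(1,2) by (auto simp: f_def intro!: subgroup.m_closed subgroup_pow_closed)
    ultimately have "f ` ({..<t} \<times> A) = B" using cardB fB by (intro card_seteq) auto
    then obtain j e where je: "b = a [^] (j::nat) \<otimes> e" "e \<in> A" using ab(2) by (auto simp: f_def)
    have eG: "e \<in> carrier G" using je subgroup.mem_carrier[OF A] by blast
    have "a \<otimes> b = a [^] j \<otimes> (a \<otimes> e)"
      using je(1) G eG commute_pow[of a a 1 j] by (simp flip: m_assoc)
    also have "\<dots> = b \<otimes> a" using AB[OF je(2) ab(1)] je(1) G eG by (simp add: m_assoc)
    finally show False using ne by simp
  qed
  have "b0 \<otimes> u = u \<otimes> b0" if u: "u \<in> S" for u
  proof (rule ccontr)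
    assume ne: "b0 \<otimes> u \<noteq> u \<otimes> b0"
    obtain s :: nat where s: "prime s" "u [^] s = \<one>" "u \<in> H" using u by (auto simp: S_def)
    have G: "u \<in> carrier G" "b0 \<in> carrier G" using s b0 H_carrier BG by auto
    \<comment> \<open>The commutator of \<open>u\<close> and \<open>b0\<close>. Its
      \<open>t\<close>-th power is trivial because \<open>b0 [^] t\<close> is central in
      \<open>E\<close>, so \<open>u\<close> normalises \<open>cyc G w\<close> and commutes with
      \<open>w\<close>. Then \<open>u [^] s = \<one>\<close> forces \<open>w [^] s = \<one>\<close>,
      so \<open>s = t\<close> and \<open>u\<close> lies in \<open>cyc G w\<close>, inside the
      abelian group \<open>B\<close>.\<close>
    define w where "w = conj_by u b0 \<otimes> inv b0"
    have wB: "w \<in> B" unfolding w_def using B(1,4) s b0 by (auto intro!: subgroup.m_closed subgroup.m_inv_closed)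
    have wG: "w \<in> carrier G" using wB BG by blast
    have ub: "conj_by u b0 = w \<otimes> b0" using G by (simp add: w_def m_assoc)
    have w1: "w \<noteq> \<one>" using ub G ne conj_by_fix_iff[OF G] by auto
    have "conj_by u (b0 [^] t) = w [^] t \<otimes> b0 [^] t"
      using pow_mult_distrib[OF Bcom[OF wB b0(1)] wG G(2)] by (simp add: conj_by_pow G ub)
    moreover have "conj_by u (b0 [^] t) = b0 [^] t"
      using AE[OF t(2)[OF b0(1)], of u] u SE G by (subst conj_by_fix_iff) auto
    ultimately have wt: "w [^] t = \<one>" using G wG by simp
    have cw: "conj_by u w \<in> B" using B(4) s wB by blast
    have "conj_by u w \<in> cyc G w"
      using H_prime_order_in_cyc[OF BH[OF cw] BH[OF wB] Bcom[OF cw wB] t(1) _ wt w1] wt G wG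
      by (simp flip: conj_by_pow)
    then have uw: "u \<otimes> w = w \<otimes> u" using H_prime_order_commute[OF s(3,1,2) BH[OF wB] t(1) wt] by blast
    have "conj_by (u [^] i) b0 = w [^] i \<otimes> b0" for i :: nat
    proof (induction i)
      case (Suc i)
      have "conj_by (u [^] Suc i) b0 = conj_by u (w [^] i \<otimes> b0)" using Suc G by (simp only: conj_by_pow_Suc)
      also have "\<dots> = w [^] i \<otimes> (w \<otimes> b0)"
        using G wG uw by (simp add: conj_by_mult conj_by_pow ub conj_by_fix_iff[THEN iffD2])
      finally show ?case using G wG by (simp add: m_assoc)
    qed (use G in simp)
    then have "w [^] s \<otimes> b0 = b0" using s(2) G by (metis conj_by_one(1))
    then have ws: "w [^] s = \<one>" using G wG by simp
    have "s = t"
      using pow_eq_one_coprime[OF wG ws wt] w1 s(1) t(1) primes_coprime by blast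
    then have "u \<in> cyc G w" using H_prime_order_in_cyc[OF s(3) BH[OF wB] uw t(1) _ wt w1] s(2) by blast
    then obtain j :: nat where "u = w [^] j" using mem_cyc_iff[OF wG fin] by blast
    then have "u \<in> B" using subgroup_pow_closed[OF B(1) wB] by blast
    then show False using Bcom[OF b0(1)] ne by blast
  qed
  then have "S \<subseteq> centralizer {b0}" using SG by (auto simp: centralizer_def)
  then have "E \<subseteq> centralizer {b0}"
    unfolding E_def using BG[OF b0(1)] by (intro generate_subgroup_incl centralizer_subgroup) auto
  then have "b0 \<in> A" using b0(1) B(3) BG[OF b0(1)] by (auto simp: A_def centralizer_def subset_iff)
  then show False using b0 by blast
qed

end

end

section \<open>The normalising graph\<close>

text \<open>Allowing equality lets every path of length at most 3 be treated as exactly three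
  \<open>near\<close> steps.\<close>

definition near :: "('a, 'b) monoid_scheme \<Rightarrow> 'a \<Rightarrow> 'a \<Rightarrow> bool" where
  "near G u v \<longleftrightarrow> u = v \<or> norm_adj G u v"

lemma near_relpowp:
  assumes "near G u v"
  shows "\<exists>k\<le>1. (norm_adj G ^^ k) u v"
proof (cases "u = v")
  case True
  then show ?thesis by (intro exI[of _ 0]) simp
next
  case False
  with assms show ?thesis
    by (intro exI[of _ 1]) (simp add: near_def eq_OO)
qed

lemma near_norm_dist_set:
  assumes "near G x a" "near G a b" "near G b n" "n \<in> N" "n \<noteq> \<one>\<^bsub>G\<^esub>"
  shows "norm_dist_set G x N \<le> 3"
proof (cases "x \<in> N")
  case False
  obtain i where i: "i \<le> 1" "(norm_adj G ^^ i) x a" using near_relpowp[OF assms(1)] by blast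
  obtain j where j: "j \<le> 1" "(norm_adj G ^^ j) a b" using near_relpowp[OF assms(2)] by blast
  obtain k where k: "k \<le> 1" "(norm_adj G ^^ k) b n" using near_relpowp[OF assms(3)] by blast
  have p: "(norm_adj G ^^ (i + j + k)) x n"
    using relpowp_trans[OF relpowp_trans[OF i(2) j(2)] k(2)] .
  have "norm_dist_set G x N \<le> norm_dist G x n"
    using False assms(4,5) by (auto simp: norm_dist_set_def intro: INF_lower)
  also have "\<dots> \<le> enat (i + j + k)" unfolding norm_dist_def using p by (intro INF_lower) simp
  also have "\<dots> \<le> 3" using i(1) j(1) k(1) by (simp add: numeral_eq_enat)
  finally show ?thesis .
qed (simp add: norm_dist_set_def)

context group
begin

lemma conj_by_image_cyc:
  assumes "u \<in> carrier G" "v \<in> carrier G" "finite (carrier G)" "conj_by u v \<in> cyc G v"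
  shows "conj_by u ` cyc G v = cyc G v"
proof (rule endo_inj_surj)
  have sub: "cyc G v \<subseteq> carrier G" using cyc_subgroup[OF assms(2)] by (rule subgroup.subset)
  show "finite (cyc G v)" using sub assms(3) by (rule finite_subset)
  show "inj_on (conj_by u) (cyc G v)" using sub assms(1) by (auto intro!: inj_onI simp: conj_by_inj subset_iff)
  show "conj_by u ` cyc G v \<subseteq> cyc G v"
  proof
    fix w assume "w \<in> conj_by u ` cyc G v"
    then obtain k :: nat where "w = conj_by u (v [^] k)" using mem_cyc_iff[OF assms(2,3)] by auto
    then show "w \<in> cyc G v"
      using assms subgroup_pow_closed[OF cyc_subgroup[OF assms(2)] assms(4)] by (simp add: conj_by_pow)
  qed
qed

text \<open>Generators suffice: conjugation by \<open>u\<close> is injective, so by finiteness it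
  maps \<open>cyc G v\<close> onto itself once it maps \<open>v\<close> into it, and this passes to
  the powers of \<open>u\<close>.\<close>

lemma nearI:
  assumes fin: "finite (carrier G)" and uv: "u \<in> carrier G" "u \<noteq> \<one>" "v \<in> carrier G" "v \<noteq> \<one>"
    and c: "conj_by u v \<in> cyc G v"
  shows "near G u v"
proof -
  have im: "conj_by u ` cyc G v = cyc G v" using fin uv c by (intro conj_by_image_cyc)
  have sub: "cyc G v \<subseteq> carrier G" using cyc_subgroup[OF uv(3)] by (rule subgroup.subset)
  have pow: "conj_by (u [^] k) ` cyc G v = cyc G v" for k :: nat
  proof (induction k)
    case (Suc k)
    have "conj_by (u [^] Suc k) ` cyc G v = conj_by u ` (conj_by (u [^] k) ` cyc G v)"
      unfolding image_image using uv sub by (intro image_cong refl conj_by_pow_Suc) auto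
    then show ?case using Suc im by simp
  qed (use sub in \<open>auto simp: subset_iff image_iff\<close>)
  have "(\<lambda>b. a \<otimes> b \<otimes> inv a) ` cyc G v = cyc G v" if a: "a \<in> cyc G u" for a
  proof -
    obtain k :: nat where k: "a = u [^] k" using a mem_cyc_iff[OF uv(1) fin] by blast
    have "(\<lambda>b. a \<otimes> b \<otimes> inv a) ` cyc G v = conj_by a ` cyc G v"
      by (intro image_cong refl) (simp add: conj_by_def)
    also have "\<dots> = cyc G v" unfolding k by (rule pow)
    finally show ?thesis .
  qed
  then have "normalises G (cyc G u) (cyc G v)" unfolding normalises_def by (intro ballI)
  then have "u \<noteq> v \<Longrightarrow> norm_adj G u v" using uv unfolding norm_adj_def by simp
  then show ?thesis unfolding near_def by blast
qed

lemma near_commute: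
  assumes fin: "finite (carrier G)" and uv: "u \<in> carrier G" "u \<noteq> \<one>" "v \<in> carrier G" "v \<noteq> \<one>"
    and c: "u \<otimes> v = v \<otimes> u"
  shows "near G u v"
proof (rule nearI[OF fin uv])
  have "v \<in> cyc G v" unfolding cyc_def by (rule generate.incl) simp
  then show "conj_by u v \<in> cyc G v" using c uv by (simp add: conj_by_fix_iff[THEN iffD2])
qed

lemma near_sym: "near G u v \<Longrightarrow> near G v u"
  unfolding near_def norm_adj_def by blast

lemma near_refl: "near G u u"
  by (simp add: near_def)

lemma centralizer_normal:
  assumes N: "N \<lhd> G"
  shows "centralizer N \<lhd> G"
proof -
  have sub: "N \<subseteq> carrier G" using N normal_imp_subgroup subgroup.subset by blast
  have "g \<otimes> c \<otimes> inv g \<in> centralizer N" if g: "g \<in> carrier G" and c: "c \<in> centralizer N" for g c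
  proof -
    have cG: "c \<in> carrier G" using c by (simp add: centralizer_def)
    have "conj_by g c \<otimes> n = n \<otimes> conj_by g c" if n: "n \<in> N" for n
    proof -
      have nG: "n \<in> carrier G" using n sub by blast
      have "conj_by (inv g) n \<in> N" using normal_conj_by[OF N _ n] g by simp
      then have "conj_by g (c \<otimes> conj_by (inv g) n) = conj_by g (conj_by (inv g) n \<otimes> c)"
        using c by (simp add: centralizer_def)
      then show ?thesis using g cG nG by (simp add: conj_by_mult)
    qed
    then show ?thesis using g cG by (simp add: centralizer_def conj_by_def)
  qed
  then show ?thesis using centralizer_subgroup[OF sub] normal_inv_iff by blast
qed

lemma commutator_eq_one_iff:
  assumes "a \<in> carrier G" "b \<in> carrier G"
  shows "a \<otimes> b \<otimes> inv a \<otimes> inv b = \<one> \<longleftrightarrow> a \<otimes> b = b \<otimes> a"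
proof -
  have "a \<otimes> b \<otimes> inv a \<otimes> inv b = a \<otimes> b \<otimes> inv (b \<otimes> a)"
    using assms by (simp add: inv_mult_group m_assoc)
  then show ?thesis using inv_solve_right'[of \<one> "a \<otimes> b" "b \<otimes> a"] assms by simp
qed

text \<open>If \<open>u\<close> has no fixed points in the finite group \<open>C\<close>, then the whole coset \<open>Cu\<close> is conjugate to \<open>u\<close> under
  \<open>C\<close>, which lets one lift centralizers from \<open>G/C\<close> to \<open>G\<close>.\<close>

lemma coset_conj_by:
  assumes fin: "finite (carrier G)" and C: "C \<lhd> G" and u: "u \<in> carrier G" "acts_fpf C u" and c: "c \<in> C"
  shows "\<exists>d\<in>C. c \<otimes> u = conj_by d u"
proof -
  interpret C: normal C G by (rule C)
  note CG = C.mem_carrier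
  define f where "f d = conj_by d u \<otimes> inv u" for d
  have "f d \<in> C" if "d \<in> C" for d
  proof -
    have "f d = d \<otimes> conj_by u (inv d)" using that u(1) CG by (simp add: f_def conj_by_def m_assoc)
    then show ?thesis using normal_conj_by[OF C u(1), of "inv d"] that by simp
  qed
  moreover have "inj_on f C"
  proof (rule inj_onI)
    fix d e assume de: "d \<in> C" "e \<in> C" "f d = f e"
    then have eq: "conj_by d u = conj_by e u" using u(1) CG by (simp add: f_def)
    have "conj_by (inv e \<otimes> d) u = conj_by (inv e) (conj_by d u)" using de u(1) CG by (simp add: conj_by_comp)
    also have "\<dots> = u" unfolding eq using de u(1) CG by simp
    finally have "u \<otimes> (inv e \<otimes> d) = (inv e \<otimes> d) \<otimes> u" using conj_by_fix_iff[of "inv e \<otimes> d" u] de u(1) CG by simp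
    then have "inv e \<otimes> d = \<one>" using u(2) de unfolding acts_fpf_def by blast
    then have "e \<otimes> (inv e \<otimes> d) = e" using de CG by simp
    then show "d = e" using de CG by simp
  qed
  ultimately have "f ` C = C" using finite_subset[OF C.subset fin] by (intro endo_inj_surj) auto
  then obtain d where "d \<in> C" "c = conj_by d u \<otimes> inv u" using c by (auto simp: f_def)
  moreover from this have "c \<otimes> u = conj_by d u" using u(1) CG by (simp add: m_assoc)
  ultimately show ?thesis by blast
qed

end

text \<open>The situation of a counterexample to the distance bound: by \<open>far\<close>, three
  \<open>near\<close> steps from \<open>x\<close> never end at a nontrivial element of
  \<open>N\<close>. The aim is to show that \<open>G\<close> is then a Frobenius group.\<close>

locale far_element = elementary_normal +
  fixes x
  assumes sol: "solvable G" and x: "x \<in> carrier G" "x \<noteq> \<one>"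
    and minimal: "\<And>M. M \<lhd> G \<Longrightarrow> M \<subseteq> N \<Longrightarrow> M = {\<one>} \<or> M = N"
    and far: "\<And>a b n. near G x a \<Longrightarrow> near G a b \<Longrightarrow> near G b n \<Longrightarrow> n \<in> N \<Longrightarrow> n = \<one>"
begin

lemma near_x: "near G x a \<Longrightarrow> a \<in> carrier G \<and> a \<noteq> \<one>"
  using x unfolding near_def norm_adj_def by blast

text \<open>A nontrivial element of \<open>N\<close> commuting with \<open>b\<close> would be a
  third step from \<open>x\<close>.\<close>

lemma far_fpf:
  assumes "near G x a" "near G a b"
  shows "acts_fpf N b"
  unfolding acts_fpf_def
proof (intro ballI impI)
  fix v assume v: "v \<in> N" "b \<otimes> v = v \<otimes> b"
  have "b \<in> carrier G" "b \<noteq> \<one>"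
    using near_x[OF assms(1)] assms(2) unfolding near_def norm_adj_def by blast+
  then have "v \<noteq> \<one> \<Longrightarrow> near G b v" using v N_carrier fin by (intro near_commute) auto
  then show "v = \<one>" using far assms v by blast
qed

definition C where "C = centralizer N"

lemma C: "C \<lhd> G"
  unfolding C_def using N by (rule centralizer_normal)

lemma C_subgroup: "subgroup C G"
  using C by (rule normal_imp_subgroup)

lemma C_carrier: "c \<in> C \<Longrightarrow> c \<in> carrier G"
  using C_subgroup by (rule subgroup.mem_carrier)

lemma C_commute: "c \<in> C \<Longrightarrow> v \<in> N \<Longrightarrow> c \<otimes> v = v \<otimes> c"
  by (simp add: C_def centralizer_def)

lemma N_subset_C: "N \<subseteq> C"
proof
  fix v assume v: "v \<in> N"
  then have "\<forall>u\<in>N. v \<otimes> u = u \<otimes> v" using comm by blast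
  then show "v \<in> C" using N_carrier[OF v] unfolding C_def centralizer_def by blast
qed

lemma N_nontriv_elem: obtains v where "v \<in> N" "v \<noteq> \<one>"
  using N_nontriv subgroup.one_closed[OF N_subgroup] by blast

text \<open>A nontrivial \<open>c\<close> in \<open>C\<close> commuting with \<open>a\<close> would
  be two steps from \<open>x\<close>, hence without fixed points on \<open>N\<close> by
  \<open>far_fpf\<close>, whereas \<open>c\<close> centralizes \<open>N\<close>.\<close>

lemma far_fpf_C:
  assumes a: "near G x a"
  shows "acts_fpf C a"
  unfolding acts_fpf_def
proof (intro ballI impI)
  fix c assume c: "c \<in> C" "a \<otimes> c = c \<otimes> a"
  show "c = \<one>"
  proof (rule ccontr)
    assume "c \<noteq> \<one>"
    then have "near G a c" using c near_x[OF a] C_carrier fin by (intro near_commute) auto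
    then have "acts_fpf N c" using far_fpf a by blast
    then show False using C_commute[OF c(1)] N_nontriv_elem unfolding acts_fpf_def by metis
  qed
qed

lemma x_notin_C: "x \<notin> C"
proof
  assume "x \<in> C"
  then have "x = \<one>" using far_fpf_C[OF near_refl[of x]] unfolding acts_fpf_def by simp
  then show False using x by simp
qed

lemma near_x_pow:
  assumes "x [^] (k::nat) \<noteq> \<one>"
  shows "near G x (x [^] k)"
proof (rule near_commute[OF fin x _ assms])
  show "x \<otimes> x [^] k = x [^] k \<otimes> x" using nat_pow_comm[of x 1 k] x by simp
qed (use x in simp)

section \<open>An elementary abelian normal section above the centralizer of
  \<open>N\<close>\<close>

context
  fixes M q
  assumes M: "M \<lhd> G" and CM: "C \<subset> M"
    and M_abelian: "\<And>a b. a \<in> M \<Longrightarrow> b \<in> M \<Longrightarrow> a \<otimes> b \<otimes> inv a \<otimes> inv b \<in> C"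
    and q: "prime (q::nat)" and M_exp: "\<And>m. m \<in> M \<Longrightarrow> m [^] q \<in> C"
begin

lemma M_subgroup: "subgroup M G"
  using M by (rule normal_imp_subgroup)

lemma M_carrier: "m \<in> M \<Longrightarrow> m \<in> carrier G"
  using M_subgroup by (rule subgroup.mem_carrier)

text \<open>The fixed points of \<open>M\<close> in \<open>N\<close> form a normal subgroup of
  \<open>G\<close>. By minimality it is trivial or all of \<open>N\<close>, and the latter would put
  \<open>M\<close> inside \<open>C\<close>.\<close>

lemma M_nofix:
  assumes v: "v \<in> N" "\<And>m. m \<in> M \<Longrightarrow> m \<otimes> v = v \<otimes> m"
  shows "v = \<one>"
proof -
  have "N \<inter> centralizer M \<lhd> G"
    using N centralizer_normal[OF M] by (rule normal_subgroup_intersect)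
  then consider "N \<inter> centralizer M = {\<one>}" | "N \<inter> centralizer M = N" using minimal by blast
  then show ?thesis
  proof cases
    case 1
    then show ?thesis using v N_carrier[OF v(1)] by (auto simp: centralizer_def)
  next
    case 2
    have "M \<subseteq> C"
    proof
      fix m assume m: "m \<in> M"
      have "m \<otimes> v = v \<otimes> m" if "v \<in> N" for v
      proof -
        have "v \<in> centralizer M" using 2 that by blast
        then show ?thesis using m by (simp add: centralizer_def)
      qed
      then show "m \<in> C" using M_carrier[OF m] by (simp add: C_def centralizer_def)
    qed
    then show ?thesis using CM by blast
  qed
qed

text \<open>If \<open>q = p\<close>, then in a minimal nontrivial \<open>M\<close>-invariant subgroup of \<open>N\<close> each \<open>m \<in> M\<close> fixes a nontrivial point, and
  the fixed points of \<open>m\<close> are \<open>M\<close>-invariant because \<open>M/C\<close> is abelian.\<close>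

lemma q_neq_p: "q \<noteq> p"
proof
  assume qp: "q = p"
  define P where "P V \<longleftrightarrow> subgroup V G \<and> V \<noteq> {\<one>} \<and> V \<subseteq> N \<and> (\<forall>m\<in>M. conj_by m ` V \<subseteq> V)" for V
  have "P N" using N_subgroup N_nontriv conj_N M_carrier by (auto simp: P_def)
  then obtain V where V: "P V" and V_min: "\<And>W. P W \<Longrightarrow> card V \<le> card W"
    using ex_has_least_nat[of P N card] by blast
  have VN: "V \<subseteq> N" and VG: "subgroup V G" and VM: "\<And>m v. m \<in> M \<Longrightarrow> v \<in> V \<Longrightarrow> conj_by m v \<in> V"
    using V by (auto simp: P_def)
  have "m \<otimes> v = v \<otimes> m" if m: "m \<in> M" and v: "v \<in> V" for m v
  proof -
    have mG: "m \<in> carrier G" using m M_carrier by blast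
    define W where "W = V \<inter> centralizer {m}"
    have W: "subgroup W G"
      unfolding W_def using VG centralizer_subgroup[of "{m}"] mG by (intro subgroups_Inter_pair) auto
    have "\<not> acts_fpf V m"
      using V VM[OF m] mG exp VN p qp M_exp[OF m] C_commute N_carrier C_carrier
      by (intro p_element_fixes_point[OF fin VG _ p]) (auto simp: P_def conj_by_fix_iff subset_iff)
    then obtain v' where v': "v' \<in> V" "m \<otimes> v' = v' \<otimes> m" "v' \<noteq> \<one>" unfolding acts_fpf_def by blast
    then have "v' \<in> W" using subgroup.mem_carrier[OF VG] by (simp add: W_def centralizer_def)
    then have "W \<noteq> {\<one>}" using v'(3) by blast
    moreover have "conj_by m' w \<in> W" if m': "m' \<in> M" and w: "w \<in> W" for m' w
    proof -
      have wV: "w \<in> V" and wN: "w \<in> N" and wm: "m \<otimes> w = w \<otimes> m"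
        using w VN by (auto simp: W_def centralizer_def)
      have G: "m' \<in> carrier G" "w \<in> carrier G" using m' wN M_carrier N_carrier by auto
      \<comment> \<open>The commutator relating \<open>m \<otimes> m'\<close> to
        \<open>m' \<otimes> m\<close>; it lies in \<open>C\<close> and so acts trivially on
        \<open>w\<close>.\<close>
      define c where "c = inv m' \<otimes> inv m \<otimes> m' \<otimes> m"
      have cC: "c \<in> C"
        using M_abelian[of "inv m'" "inv m"] m m' M_subgroup G mG by (simp add: c_def subgroup.m_inv_closed)
      have "conj_by m (conj_by m' w) = conj_by (m' \<otimes> m \<otimes> inv c) w"
      proof -
        have "m \<otimes> m' = m' \<otimes> m \<otimes> inv c" using G mG by (simp add: c_def inv_mult_group m_assoc)
        then show ?thesis using G mG by (simp flip: conj_by_comp)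
      qed
      also have "\<dots> = conj_by m' (conj_by m (conj_by (inv c) w))"
        using G mG C_carrier[OF cC] by (simp add: conj_by_comp)
      also have "conj_by (inv c) w = w"
        using C_commute[OF _ wN, of "inv c"] subgroup.m_inv_closed[OF C_subgroup cC] C_carrier G
        by (simp add: conj_by_fix_iff)
      also have "conj_by m w = w" using wm G mG by (simp add: conj_by_fix_iff)
      finally have "m \<otimes> conj_by m' w = conj_by m' w \<otimes> m" using G mG by (simp add: conj_by_fix_iff)
      moreover have "conj_by m' w \<in> V" using VM m' wV by blast
      ultimately show ?thesis using G by (simp add: W_def centralizer_def)
    qed
    ultimately have "P W" using W VN by (auto simp: P_def W_def)
    then have "card V \<le> card W" by (rule V_min)
    moreover have "finite V" using VN N_carrier fin by (meson finite_subset subsetI)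
    ultimately have "W = V" by (intro card_seteq) (auto simp: W_def)
    then have "v \<in> centralizer {m}" using v unfolding W_def by blast
    then show ?thesis by (simp add: centralizer_def)
  qed
  then have "V \<subseteq> {\<one>}" using M_nofix VN by blast
  moreover have "\<one> \<in> V" using VG by (rule subgroup.one_closed)
  ultimately show False using V by (auto simp: P_def)
qed

text \<open>The centralizer of \<open>u\<close> in \<open>M\<close> meets \<open>C\<close> trivially
  by \<open>far_fpf_C\<close>, so it inherits exponent \<open>q\<close> and commutativity from
  \<open>M/C\<close>. Its nontrivial elements are near \<open>u\<close> and act freely on
  \<open>N\<close>, so \<open>commuting_prime_order_in_cyc\<close> makes it cyclic.\<close>

lemma M_centralizer:
  assumes u: "near G x u" and m: "m \<in> M" "u \<otimes> m = m \<otimes> u"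
  shows "m [^] q = \<one>"
    and "\<And>k. k \<in> M \<Longrightarrow> u \<otimes> k = k \<otimes> u \<Longrightarrow> m \<noteq> \<one> \<Longrightarrow> k \<in> cyc G m"
proof -
  have uG: "u \<in> carrier G" "u \<noteq> \<one>" using near_x[OF u] by auto
  have Z: "subgroup (centralizer {u}) G" using uG by (intro centralizer_subgroup) simp
  have Zmem: "k \<in> centralizer {u} \<longleftrightarrow> k \<in> carrier G \<and> u \<otimes> k = k \<otimes> u" for k
    by (auto simp: centralizer_def)
  have CZ: "c = \<one>" if "c \<in> C" "c \<in> centralizer {u}" for c
    using far_fpf_C[OF u] that Zmem unfolding acts_fpf_def by blast
  have pw: "k [^] q = \<one>" if "k \<in> M" "u \<otimes> k = k \<otimes> u" for k
    using that M_exp M_carrier Zmem subgroup_pow_closed[OF Z, of k q] by (intro CZ) auto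
  show mq: "m [^] q = \<one>" using pw m by blast
  fix k assume k: "k \<in> M" "u \<otimes> k = k \<otimes> u" and m1: "m \<noteq> \<one>"
  have G: "k \<in> carrier G" "m \<in> carrier G" using k m M_carrier by auto
  have kZ: "k \<in> centralizer {u}" "m \<in> centralizer {u}" using k m G Zmem by auto
  have "k \<otimes> m \<otimes> inv k \<otimes> inv m \<in> centralizer {u}"
    using kZ Z by (intro subgroup.m_closed subgroup.m_inv_closed)
  then have "k \<otimes> m \<otimes> inv k \<otimes> inv m = \<one>" using CZ M_abelian k m by blast
  then have km: "k \<otimes> m = m \<otimes> k" using G by (simp only: commutator_eq_one_iff)
  show "k \<in> cyc G m"
  proof (rule commuting_prime_order_in_cyc[OF G km q pw[OF k] mq m1])
    fix i j :: nat assume ne: "k [^] i \<otimes> m [^] j \<noteq> \<one>"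
    have "k [^] i \<otimes> m [^] j \<in> centralizer {u}"
      using kZ Z by (intro subgroup.m_closed subgroup_pow_closed)
    then have "near G u (k [^] i \<otimes> m [^] j)" using Zmem ne uG fin by (intro near_commute) auto
    then show "acts_fpf N (k [^] i \<otimes> m [^] j)" using far_fpf u by blast
  qed
qed

lemma exists_near_x_in_M:
  obtains m where "m \<in> M" "m \<notin> C" "near G x m" "conj_by x m \<in> cyc G m"
proof -
  obtain k r :: nat where r: "prime r" "x [^] k \<noteq> \<one>" "(x [^] k) [^] r = \<one>"
    using exists_prime_pow[OF x fin] by blast
  define y where "y = x [^] k"
  have yG: "y \<in> carrier G" using x by (simp add: y_def)
  have y: "near G x y" unfolding y_def using r(2) by (rule near_x_pow)
  have "\<exists>m\<in>M - C. y \<otimes> m = m \<otimes> y"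
  proof -
    have "\<exists>i m. 0 < i \<and> i < r \<and> m \<in> M - C \<and> conj_by m (y [^] i) \<otimes> inv (y [^] i) \<in> C"
    proof (rule frobenius_kernel_action[OF M_subgroup C _ _ _ q _ q_neq_p yG _ far_fpf[OF near_refl y]])
      show "C \<subseteq> M" using CM by blast
      show "c \<otimes> v = v \<otimes> c" if "c \<in> C" "v \<in> N" for c v using that by (rule C_commute)
      show "v = \<one>" if "v \<in> N" "\<And>m. m \<in> M \<Longrightarrow> m \<otimes> v = v \<otimes> m" for v using that by (rule M_nofix)
      show "m [^] q \<in> C" if "m \<in> M" for m using that by (rule M_exp)
      show "conj_by y m \<in> M" if "m \<in> M" for m using normal_conj_by[OF M yG that] .
      show "y [^] r = \<one>" using r(3) by (simp add: y_def)
      show "0 < r" using prime_gt_0_nat[OF r(1)] .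
    qed
    then obtain i m where i: "0 < i" "i < r" and m: "m \<in> M - C" "conj_by m (y [^] i) \<otimes> inv (y [^] i) \<in> C"
      by blast
    define u where "u = y [^] i"
    have mG: "m \<in> carrier G" using m M_carrier by blast
    have uG: "u \<in> carrier G" using yG by (simp add: u_def)
    have "coprime i r" using i r(1) nat_dvd_not_less prime_imp_coprime coprime_commute by blast
    then have u1: "u \<noteq> \<one>" using pow_eq_one_coprime[OF yG, of i r] r by (auto simp: u_def y_def)
    have "u = x [^] (k * i)" using x by (simp add: u_def y_def nat_pow_pow)
    then have "near G x u" using near_x_pow[of "k * i"] u1 by simp
    \<comment> \<open>\<open>conj_by m u\<close> lies in the coset \<open>Cu\<close>, hence is
      conjugate to \<open>u\<close> under some \<open>d\<close> in \<open>C\<close>. Correcting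
      \<open>m\<close> to \<open>inv d \<otimes> m\<close> turns commuting modulo \<open>C\<close>
      into commuting exactly.\<close>
    then obtain d where d: "d \<in> C" "conj_by m u \<otimes> inv u \<otimes> u = conj_by d u"
      using coset_conj_by[OF fin C uG far_fpf_C] m(2) by (metis u_def)
    have dG: "d \<in> carrier G" using d C_carrier by blast
    have "conj_by m u = conj_by d u" using d(2) mG uG by (simp add: m_assoc)
    then have "conj_by (inv d \<otimes> m) u = u" using dG mG uG by (simp add: conj_by_comp)
    then have com: "u \<otimes> (inv d \<otimes> m) = (inv d \<otimes> m) \<otimes> u" using dG mG uG by (simp add: conj_by_fix_iff)
    obtain j :: nat where j: "y = u [^] j"
      using pow_prime_gen[OF yG _ r(1), of i] r(3) u1 by (auto simp: u_def y_def)
    have "y \<otimes> (inv d \<otimes> m) = (inv d \<otimes> m) \<otimes> y"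
      using commute_pow[OF com, of j 1] j uG dG mG by simp
    moreover have "inv d \<otimes> m \<in> M"
      using d m CM M_subgroup by (auto intro!: subgroup.m_closed subgroup.m_inv_closed)
    moreover have "inv d \<otimes> m \<notin> C"
    proof
      assume "inv d \<otimes> m \<in> C"
      then have "d \<otimes> (inv d \<otimes> m) \<in> C" using d(1) C_subgroup by (simp add: subgroup.m_closed)
      then show False using m dG mG by simp
    qed
    ultimately show ?thesis by blast
  qed
  then obtain m where m: "m \<in> M" "m \<notin> C" "y \<otimes> m = m \<otimes> y" by blast
  have mG: "m \<in> carrier G" using m M_carrier by blast
  have m1: "m \<noteq> \<one>" using m(2) subgroup.one_closed[OF C_subgroup] by blast
  \<comment> \<open>As \<open>x\<close> commutes with \<open>y\<close>, it preserves the centralizer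
    of \<open>y\<close> in \<open>M\<close>, which is \<open>cyc G m\<close>.\<close>
  have "conj_by x y = y" using x yG commute_pow[of x x 1 k] by (simp add: conj_by_fix_iff y_def)
  then have "y \<otimes> conj_by x m = conj_by x m \<otimes> y"
    using arg_cong[OF m(3), of "conj_by x"] x yG mG by (simp add: conj_by_mult)
  moreover have "conj_by x m \<in> M" using normal_conj_by[OF M x(1) m(1)] .
  ultimately have c: "conj_by x m \<in> cyc G m" using M_centralizer(2)[OF y m(1,3)] m1 by blast
  then have "near G x m" using fin x mG m1 by (intro nearI) auto
  then show ?thesis using that m c by blast
qed

lemma frobenius_if_section: "frobenius_group G"
proof -
  obtain m where m: "m \<in> M" "m \<notin> C" and xm: "near G x m" "conj_by x m \<in> cyc G m"
    by (rule exists_near_x_in_M)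
  have mG: "m \<in> carrier G" "m \<noteq> \<one>" using near_x[OF xm(1)] by auto
  have mq: "m [^] q = \<one>" using M_centralizer(1)[OF xm(1) m(1)] by simp
  \<comment> \<open>The normaliser of \<open>cyc G m\<close>; by finiteness it is enough to test the
    generator.\<close>
  define H where "H = {h \<in> carrier G. conj_by h m \<in> cyc G m}"
  have Qmem: "k \<in> cyc G m \<longleftrightarrow> (\<exists>j::nat. k = m [^] j)" for k by (rule mem_cyc_iff[OF mG(1) fin])
  have mQ: "m \<in> cyc G m" unfolding cyc_def by (rule generate.incl) simp
  have gen: "\<exists>i::nat. m = k [^] i" if k: "k \<in> cyc G m" "k \<noteq> \<one>" for k
  proof -
    obtain j :: nat where "k = m [^] j" using k Qmem by blast
    then show ?thesis using pow_prime_gen[OF mG(1) mq q, of j] k by blast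
  qed
  have QC: "k = \<one>" if k: "k \<in> cyc G m" "k \<in> C" for k
  proof (rule ccontr)
    assume "k \<noteq> \<one>"
    then obtain i :: nat where "m = k [^] i" using gen k(1) by blast
    then show False using m(2) k(2) subgroup_pow_closed[OF C_subgroup] by blast
  qed
  have H: "subgroup H G"
  proof (rule subgroupI)
    show "H \<subseteq> carrier G" by (auto simp: H_def)
    show "H \<noteq> {}" using x xm by (auto simp: H_def)
    fix a assume a: "a \<in> H"
    then have aG: "a \<in> carrier G" and im: "conj_by a ` cyc G m = cyc G m"
      using conj_by_image_cyc[OF _ mG(1) fin] by (auto simp: H_def)
    obtain k where k: "k \<in> cyc G m" "m = conj_by a k" using mQ im by blast
    then have "conj_by (inv a) m = k" using aG subgroup.mem_carrier[OF cyc_subgroup[OF mG(1)]] by simp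
    then show "inv a \<in> H" using aG k by (simp add: H_def)
    fix b assume b: "b \<in> H"
    then have "conj_by a (conj_by b m) \<in> cyc G m" using im by (auto simp: H_def)
    then show "a \<otimes> b \<in> H" using aG b mG by (simp add: H_def conj_by_comp)
  qed
  have HG: "h \<in> carrier G" if "h \<in> H" for h using that by (simp add: H_def)
  have near_H: "near G m h" if "h \<in> H" "h \<noteq> \<one>" for h
    using that mG fin by (intro near_sym[OF nearI]) (auto simp: H_def)
  have xH: "x \<in> H" using x xm by (simp add: H_def)
  \<comment> \<open>The commutator of \<open>h\<close> and \<open>m\<close> lies in both
    \<open>C\<close> and \<open>cyc G m\<close>, hence is trivial; but \<open>m\<close> commutes
    with no nontrivial element of \<open>C\<close>.\<close>
  have CH: "h = \<one>" if h: "h \<in> C" "h \<in> H" for h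
  proof -
    have hG: "h \<in> carrier G" using h C_carrier by blast
    have "conj_by h m \<otimes> inv m = h \<otimes> conj_by m (inv h)" using hG mG by (simp add: conj_by_def m_assoc)
    moreover have "h \<otimes> conj_by m (inv h) \<in> C"
      using h C_subgroup normal_conj_by[OF C mG(1)] by (auto intro!: subgroup.m_closed subgroup.m_inv_closed)
    moreover have "conj_by h m \<otimes> inv m \<in> cyc G m"
      using h mQ cyc_subgroup[OF mG(1)] by (auto simp: H_def intro!: subgroup.m_closed subgroup.m_inv_closed)
    ultimately have "conj_by h m \<otimes> inv m = \<one>" using QC by simp
    then have "conj_by h m = m" using hG mG by (metis conj_by_closed inv_closed inv_equality inv_inv)
    then have "m \<otimes> h = h \<otimes> m" using hG mG by (simp add: conj_by_fix_iff)
    then show ?thesis using far_fpf_C[OF xm(1)] h unfolding acts_fpf_def by blast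
  qed
  \<comment> \<open>\<open>k\<close> fixes \<open>m\<close> modulo \<open>C\<close>, so by
    \<open>coset_conj_by\<close> some \<open>inv d \<otimes> k\<close> with \<open>d\<close> in
    \<open>C\<close> centralizes \<open>m\<close> and is therefore a power of
    \<open>m\<close>.\<close>
  have M_eq: "\<exists>c\<in>C. \<exists>j::nat. k = c \<otimes> m [^] j" if k: "k \<in> M" for k
  proof -
    have kG: "k \<in> carrier G" using k M_carrier by blast
    have "conj_by k m \<otimes> inv m \<in> C" using M_abelian[OF k m(1)] by (simp add: conj_by_def)
    then obtain d where d: "d \<in> C" "conj_by k m \<otimes> inv m \<otimes> m = conj_by d m"
      using coset_conj_by[OF fin C mG(1) far_fpf_C[OF xm(1)]] by blast
    have dG: "d \<in> carrier G" using d C_carrier by blast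
    have "conj_by k m = conj_by d m" using d(2) mG kG by (simp add: m_assoc)
    then have "conj_by (inv d \<otimes> k) m = m" using dG kG mG by (simp add: conj_by_comp)
    then have "m \<otimes> (inv d \<otimes> k) = (inv d \<otimes> k) \<otimes> m" using dG mG kG by (simp add: conj_by_fix_iff)
    moreover have "inv d \<otimes> k \<in> M"
      using d k CM M_subgroup by (auto intro!: subgroup.m_closed subgroup.m_inv_closed)
    ultimately have "inv d \<otimes> k \<in> cyc G m" using M_centralizer(2)[OF xm(1) m(1) refl] mG by blast
    then obtain j :: nat where "inv d \<otimes> k = m [^] j" using Qmem by blast
    then have "k = d \<otimes> m [^] j" using dG kG mG by (simp add: inv_solve_left')
    then show ?thesis using d by blast
  qed
  \<comment> \<open>A Frattini argument: \<open>conj_by g m\<close> lies in \<open>C\<close> times a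
    nontrivial power of \<open>m\<close>, and is conjugate to that power under some \<open>d\<close>
    in \<open>C\<close>. Then \<open>inv d \<otimes> g\<close> normalises
    \<open>cyc G m\<close>.\<close>
  have GCH: "\<exists>d\<in>C. \<exists>h\<in>H. g = d \<otimes> h" if g: "g \<in> carrier G" for g
  proof -
    obtain c and j :: nat where c: "c \<in> C" "conj_by g m = c \<otimes> m [^] j"
      using M_eq normal_conj_by[OF M g m(1)] by blast
    have cG: "c \<in> carrier G" using c C_carrier by blast
    have ne: "m [^] j \<noteq> \<one>"
    proof
      assume "m [^] j = \<one>"
      then have "conj_by g m \<in> C" using c cG by simp
      then have "conj_by (inv g) (conj_by g m) \<in> C" using normal_conj_by[OF C] g by simp
      then show False using m(2) g mG by simp
    qed
    have jQ: "m [^] j \<in> cyc G m" using Qmem by blast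
    obtain i :: nat where i: "m = (m [^] j) [^] i" using gen[OF jQ ne] by blast
    have "acts_fpf C (m [^] j)"
      unfolding acts_fpf_def
    proof (intro ballI impI)
      fix e assume e: "e \<in> C" "m [^] j \<otimes> e = e \<otimes> m [^] j"
      then have "m \<otimes> e = e \<otimes> m" using commute_pow[OF e(2), of i 1] i C_carrier mG by simp
      then show "e = \<one>" using far_fpf_C[OF xm(1)] e unfolding acts_fpf_def by blast
    qed
    then obtain d where d: "d \<in> C" "c \<otimes> m [^] j = conj_by d (m [^] j)"
      using coset_conj_by[OF fin C _ _ c(1), of "m [^] j"] mG by auto
    have dG: "d \<in> carrier G" using d C_carrier by blast
    have "conj_by (inv d \<otimes> g) m = m [^] j" using dG g mG c(2) d(2) by (simp add: conj_by_comp)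
    then have "inv d \<otimes> g \<in> H" using jQ dG g by (simp add: H_def)
    moreover have "g = d \<otimes> (inv d \<otimes> g)" using dG g by simp
    ultimately show ?thesis using d by blast
  qed
  have fpfN: "acts_fpf N h" if "h \<in> H" "h \<noteq> \<one>" for h
    using far_fpf[OF xm(1) near_H[OF that]] .
  \<comment> \<open>For an involution \<open>h\<close>, the product of \<open>v\<close> and
    \<open>conj_by h v\<close> is a fixed point, hence trivial. So \<open>h\<close> inverts
    \<open>v\<close> and is near it, giving the forbidden walk from \<open>x\<close> through
    \<open>m\<close> and \<open>h\<close> to \<open>v\<close>.\<close>
  have no_inv: "h = \<one>" if h: "h \<in> H" "h \<otimes> h = \<one>" for h
  proof (rule ccontr)
    assume h1: "h \<noteq> \<one>"
    obtain v where v: "v \<in> N" "v \<noteq> \<one>" by (rule N_nontriv_elem)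
    have G: "h \<in> carrier G" "v \<in> carrier G" using h v HG N_carrier by auto
    have cN: "conj_by h v \<in> N" using conj_N G v by blast
    define w where "w = v \<otimes> conj_by h v"
    have "conj_by h w = conj_by h v \<otimes> conj_by (h \<otimes> h) v" using G by (simp add: w_def conj_by_mult conj_by_comp)
    also have "\<dots> = w" using h G comm[OF cN v(1)] by (simp add: w_def)
    finally have "h \<otimes> w = w \<otimes> h" using G by (simp add: w_def conj_by_fix_iff)
    moreover have "w \<in> N" unfolding w_def using v cN N_subgroup by (simp add: subgroup.m_closed)
    ultimately have "w = \<one>" using fpfN[OF h(1) h1] unfolding acts_fpf_def by blast
    then have "conj_by h v = inv v" using G comm[OF cN v(1)] unfolding w_def
      by (metis conj_by_closed inv_equality)
    then have "conj_by h v \<in> cyc G v"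
      using cyc_subgroup[OF G(2)] by (simp add: cyc_def generate.inv)
    then have "near G h v" using fin G h1 v by (intro nearI)
    then show False using far[OF xm(1) near_H[OF h(1) h1]] v by blast
  qed
  \<comment> \<open>Pass to a power \<open>u\<close> of \<open>h\<close> of prime order. It commutes
    with \<open>conj_by x u\<close>, so both generate the same subgroup; thus \<open>x\<close>
    normalises \<open>cyc G u\<close>, and \<open>far_fpf_C\<close> applies to
    \<open>u\<close>.\<close>
  have fpfC: "acts_fpf C h" if h: "h \<in> H" "h \<noteq> \<one>" for h
    unfolding acts_fpf_def
  proof (intro ballI impI)
    fix c assume c: "c \<in> C" "h \<otimes> c = c \<otimes> h"
    obtain k s :: nat where s: "prime s" "h [^] k \<noteq> \<one>" "(h [^] k) [^] s = \<one>"
      using exists_prime_pow[OF HG[OF h(1)] h(2) fin] by blast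
    define u where "u = h [^] k"
    have uH: "u \<in> H" unfolding u_def using H h(1) by (rule subgroup_pow_closed)
    have uG: "u \<in> carrier G" using uH HG by blast
    have xuH: "conj_by x u \<in> H"
      unfolding conj_by_def using H xH uH by (auto intro!: subgroup.m_closed subgroup.m_inv_closed)
    have us: "u [^] s = \<one>" "u \<noteq> \<one>" using s by (auto simp: u_def)
    then have xus: "conj_by x u [^] s = \<one>" using x uG by (simp flip: conj_by_pow)
    have "conj_by x u \<otimes> u = u \<otimes> conj_by x u"
      by (rule H_prime_order_elements_commute[OF sol H fpfN no_inv xuH s(1) xus uH s(1) us(1)])
    then have "conj_by x u \<in> cyc G u"
      using H_prime_order_in_cyc[OF sol H fpfN no_inv xuH uH _ s(1) xus us] by blast
    then have "near G x u" using fin x uG us by (intro nearI)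
    moreover have "u \<otimes> c = c \<otimes> u"
      using commute_pow[OF c(2) HG[OF h(1)] C_carrier[OF c(1)], of k 1] C_carrier[OF c(1)] by (simp add: u_def)
    ultimately show "c = \<one>" using far_fpf_C c(1) unfolding acts_fpf_def by blast
  qed
  \<comment> \<open>Write \<open>g = d \<otimes> k\<close> with \<open>d\<close> in \<open>C\<close>
    and \<open>k\<close> in \<open>H\<close>. Then \<open>h = conj_by d k1\<close>, and
    \<open>inv k1 \<otimes> h\<close> lies in both \<open>C\<close> and \<open>H\<close>, so
    \<open>d\<close> commutes with \<open>k1\<close>. Since \<open>g\<close> is outside
    \<open>H\<close>, \<open>d\<close> is nontrivial, and \<open>fpfC\<close> forces
    \<open>k1 = \<one>\<close>.\<close>
  have "H \<inter> (\<lambda>h. g \<otimes> h \<otimes> inv g) ` H = {\<one>}" if g: "g \<in> carrier G - H" for g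
  proof (intro equalityI subsetI)
    fix h assume "h \<in> H \<inter> (\<lambda>h. g \<otimes> h \<otimes> inv g) ` H"
    then obtain h1 where h: "h \<in> H" "h1 \<in> H" "h = conj_by g h1" by (auto simp: conj_by_def)
    obtain d k where dk: "d \<in> C" "k \<in> H" "g = d \<otimes> k" using GCH g by blast
    have G: "d \<in> carrier G" "k \<in> carrier G" "h \<in> carrier G" "h1 \<in> carrier G"
      using dk h C_carrier HG by auto
    define k1 where "k1 = conj_by k h1"
    have k1: "k1 \<in> H" unfolding k1_def conj_by_def using H dk h by (auto intro!: subgroup.m_closed subgroup.m_inv_closed)
    have k1G: "k1 \<in> carrier G" using k1 HG by blast
    have hd: "h = conj_by d k1" using h(3) dk(3) G by (simp add: k1_def conj_by_comp)
    have "inv k1 \<otimes> h = conj_by (inv k1) d \<otimes> inv d"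
      unfolding hd using G k1G by (simp add: conj_by_def m_assoc)
    moreover have "conj_by (inv k1) d \<otimes> inv d \<in> C"
      using dk(1) k1G normal_conj_by[OF C, of "inv k1" d] C_subgroup
      by (auto intro!: subgroup.m_closed subgroup.m_inv_closed)
    moreover have "inv k1 \<otimes> h \<in> H" using k1 h H by (auto intro!: subgroup.m_closed subgroup.m_inv_closed)
    ultimately have "inv k1 \<otimes> h = \<one>" using CH by simp
    then have hk: "h = k1" using G k1G by (simp add: inv_solve_left')
    then have "d \<otimes> k1 = k1 \<otimes> d" using hd G k1G by (metis conj_by_fix_iff)
    moreover have "d \<noteq> \<one>" using g dk G by auto
    ultimately have "k1 = \<one>" using fpfC[OF k1] dk(1) unfolding acts_fpf_def by metis
    then show "h \<in> {\<one>}" using hk by simp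
  next
    fix h assume "h \<in> {\<one>}"
    then show "h \<in> H \<inter> (\<lambda>h. g \<otimes> h \<otimes> inv g) ` H"
      using g subgroup.one_closed[OF H] by (auto intro!: rev_image_eqI[of \<one>])
  qed
  moreover have "H \<noteq> {\<one>}" using xH x by auto
  moreover have "H \<noteq> carrier G"
    using CH N_subset_C N_carrier N_nontriv_elem by (metis subsetD)
  ultimately show ?thesis unfolding frobenius_group_def using fin H by blast
qed

end

text \<open>As \<open>x\<close> lies outside \<open>C\<close>, solubility supplies a nontrivial
  elementary abelian section \<open>M/C\<close> with \<open>M\<close> normal in
  \<open>G\<close>.\<close>

lemma frobenius: "frobenius_group G"
proof -
  have "C \<subset> carrier G" using x_notin_C x C_carrier by blast
  then obtain M and q :: nat where M: "subgroup M G" "C \<subset> M" "\<And>h b. h \<in> carrier G \<Longrightarrow> b \<in> M \<Longrightarrow> conj_by h b \<in> M"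
    "\<And>a b. a \<in> M \<Longrightarrow> b \<in> M \<Longrightarrow> a \<otimes> b \<otimes> inv a \<otimes> inv b \<in> C"
    and q: "prime q" "\<And>b. b \<in> M \<Longrightarrow> b [^] q \<in> C"
    by (rule exists_abelian_section[OF fin sol C_subgroup subgroup_self _ normal_conj_by[OF C] subset_refl normal_conj_by[OF C] conj_by_closed])
      (assumption | rule that)+
  have "M \<lhd> G" using M(1,3) by (simp add: normal_inv_iff conj_by_def)
  then show ?thesis using M(2,4) q by (rule frobenius_if_section)
qed

end

text \<open>The abelian section between \<open>{\<one>}\<close> and \<open>N\<close> is normal in
  \<open>G\<close>, so by minimality it is \<open>N\<close>, which is therefore elementary
  abelian.\<close>

lemma (in group) norm_dist_le_3_or_frobenius:
  assumes fin: "finite (carrier G)" and sol: "solvable G" and mN: "minimal_normal G N"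
    and x: "x \<in> carrier G" "x \<noteq> \<one>" and far: "\<not> norm_dist_set G x N \<le> 3"
  shows "frobenius_group G"
proof -
  have N: "N \<lhd> G" "N \<noteq> {\<one>}" and minimal: "\<And>M. M \<lhd> G \<Longrightarrow> M \<subseteq> N \<Longrightarrow> M = {\<one>} \<or> M = N"
    using mN by (auto simp: minimal_normal_def)
  have one: "subgroup {\<one>} G" using normal_imp_subgroup[OF one_is_normal] .
  have "{\<one>} \<subset> N" using N(2) subgroup.one_closed[OF normal_imp_subgroup[OF N(1)]] by blast
  then obtain B and p :: nat where B: "subgroup B G" "{\<one>} \<subset> B" "B \<subseteq> N"
    "\<And>h b. h \<in> carrier G \<Longrightarrow> b \<in> B \<Longrightarrow> conj_by h b \<in> B"
    "\<And>a b. a \<in> B \<Longrightarrow> b \<in> B \<Longrightarrow> a \<otimes> b \<otimes> inv a \<otimes> inv b \<in> {\<one>}"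
    and p: "prime p" "\<And>b. b \<in> B \<Longrightarrow> b [^] p \<in> {\<one>}"
    by (rule exists_abelian_section[OF fin sol one normal_imp_subgroup[OF N(1)] _ _ subset_refl normal_conj_by[OF one_is_normal] normal_conj_by[OF N(1)]])
      (use subgroup.mem_carrier[OF normal_imp_subgroup[OF N(1)]] in \<open>simp; fail\<close> | assumption | rule that)+
  have "B \<lhd> G" using B(1,4) by (simp add: normal_inv_iff conj_by_def)
  then have BN: "B = N" using minimal B(2,3) by blast
  have el: "elementary_normal G N p"
  proof (intro elementary_normal.intro elementary_normal_axioms.intro is_group)
    fix u v assume uv: "u \<in> N" "v \<in> N"
    then have G: "u \<in> carrier G" "v \<in> carrier G" using BN subgroup.mem_carrier[OF B(1)] by auto
    have "u \<otimes> v \<otimes> inv u \<otimes> inv v = \<one>" using B(5)[of u v] uv BN by blast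
    then show "u \<otimes> v = v \<otimes> u" using G by (simp only: commutator_eq_one_iff)
  qed (use fin N p BN in auto)
  have "far_element G N p x"
  proof (intro far_element.intro far_element_axioms.intro el sol x minimal)
    fix a b n assume "near G x a" "near G a b" "near G b n" "n \<in> N"
    then show "n = \<one>" using near_norm_dist_set[of G x a b n N] far by blast
  qed
  then show ?thesis by (rule far_element.frobenius)
qed

theorem mainTheorem6:
  fixes G :: "('a, 'b) monoid_scheme" and N :: "'a set" and x :: 'a
  assumes "group G" and "finite (carrier G)" and "solvable G"
    and "minimal_normal G N"
    and "x \<in> carrier G" and "x \<noteq> \<one>\<^bsub>G\<^esub>"
  shows "norm_dist_set G x N \<le> 3 \<or> frobenius_group G"
  using group.norm_dist_le_3_or_frobenius[OF assms] by blast

end
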